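(* Let $G$ be an abelian group. A function $\phi:G\to\mathbb{H}$ is positive definite if and only if there exists a (not necessarily unique) nonnegative finite Radon measure $\mu$ on $G^\delta$ such that $$\phi(g)=\int_{G^\delta}\gamma(g)\,d\mu(\gamma)\quad\text{for all } g\in G.$$
   Context: $\mathbb{H}$ is the real quaternion algebra, $\mathbb{S}=\{q\in\mathbb{H}:|q|=1\}$. For an abelian group $G$, $\phi:G\to\mathbb{H}$ is positive definite if for all $k$, $g_i\in G$, $q_i\in\mathbb{H}$, $\sum_{i,j=1}^k\overline{q_i}\,\phi(g_j-g_i)\,q_j$ is a nonnegative real number. The quaternionic dual $G^\delta=\mathrm{Hom}(G,\mathbb{S})$ is the set of group homomorphisms $G\to\mathbb{S}$, equipped with the topology of pointwise convergence (it is a compact Hausdorff space). Integrals of $\mathbb{H}$-valued functions are taken componentwise. *)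

theory Defs
  imports "HOL-Analysis.Analysis"
begin

text \<open>Real quaternions are represented as vectors in real^4:
  component 1 = real part, components 2,3,4 = i,j,k parts.
  The Euclidean norm on real^4 is the quaternion modulus.\<close>

type_synonym quat = "real ^ 4"

definition qmul :: "quat \<Rightarrow> quat \<Rightarrow> quat" where
  "qmul p q = (\<chi> n. if n = 1 then p$1*q$1 - p$2*q$2 - p$3*q$3 - p$4*q$4
                 else if n = 2 then p$1*q$2 + p$2*q$1 + p$3*q$4 - p$4*q$3
                 else if n = 3 then p$1*q$3 - p$2*q$4 + p$3*q$1 + p$4*q$2
                 else p$1*q$4 + p$2*q$3 - p$3*q$2 + p$4*q$1)"

definition qcnj :: "quat \<Rightarrow> quat" where
  "qcnj q = (\<chi> n. if n = 1 then q$1 else - (q$n))"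

definition qnonneg_real :: "quat \<Rightarrow> bool" where
  "qnonneg_real q \<longleftrightarrow> q$2 = 0 \<and> q$3 = 0 \<and> q$4 = 0 \<and> q$1 \<ge> 0"

definition pos_def :: "('g::ab_group_add \<Rightarrow> quat) \<Rightarrow> bool" where
  "pos_def \<phi> \<longleftrightarrow> (\<forall>(k::nat) (g::nat \<Rightarrow> 'g) (q::nat \<Rightarrow> quat).
     qnonneg_real (\<Sum>i\<in>{1..k}. \<Sum>j\<in>{1..k}. qmul (qmul (qcnj (q i)) (\<phi> (g j - g i))) (q j)))"

definition qdual :: "('g::ab_group_add \<Rightarrow> quat) set" where
  "qdual = {\<gamma>. (\<forall>a. norm (\<gamma> a) = 1) \<and> (\<forall>a b. \<gamma> (a + b) = qmul (\<gamma> a) (\<gamma> b))}"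

definition qdual_top :: "('g::ab_group_add \<Rightarrow> quat) topology" where
  "qdual_top = subtopology (product_topology (\<lambda>_. euclidean) UNIV) qdual"

text \<open>Radon measure on a topological space (Folland): Borel, outer regular on all
  Borel sets, inner regular (by compact sets) on open sets.\<close>
definition radon_on :: "'a topology \<Rightarrow> 'a measure \<Rightarrow> bool" where
  "radon_on T M \<longleftrightarrow>
     space M = topspace T \<and>
     sets M = sigma_sets (topspace T) {U. openin T U} \<and>
     (\<forall>A\<in>sets M. emeasure M A = (INF U\<in>{U. openin T U \<and> A \<subseteq> U}. emeasure M U)) \<and>
     (\<forall>U. openin T U \<longrightarrow> emeasure M U = (SUP K\<in>{K. compactin T K \<and> K \<subseteq> U}. emeasure M K))"

end

theory Submission
  imports Defs "HOL-Library.Function_Algebras"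
begin

text \<open>
  If \<open>\<mu>\<close> represents \<open>\<phi>\<close>, the quadratic form of \<open>\<phi>\<close> is the integral of
  \<open>|\<Sum>\<^sub>i \<gamma>(g\<^sub>i) q\<^sub>i|\<^sup>2\<close>. For the converse, let \<open>P\<close> be the compact convex set of positive definite
  functions with \<open>\<phi>(0) = 1\<close>. The functions \<open>\<phi>(x) + c\<^sup>* \<phi>(x) c \<plusminus> (\<phi>(x+a) c + c\<^sup>* \<phi>(x-a))\<close> are
  positive definite, so if \<open>\<phi>\<close> is extreme in \<open>P\<close> and the unit quaternion \<open>c\<close> commutes with all \<open>\<phi>(x)\<close>,
  then \<open>\<phi>(x+a) c + c\<^sup>* \<phi>(x-a)\<close> is a real multiple of \<open>\<phi>(x)\<close>. Taking \<open>c = 1\<close> gives d'Alembert's equation,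
  which forces the imaginary parts of \<open>\<phi>\<close> to be parallel to one imaginary unit \<open>u\<close>; taking \<open>c = u\<close>
  then gives \<open>\<phi>(x+a) = \<phi>(a) \<phi>(x)\<close>. Hence every extreme point of \<open>P\<close> lies in the quaternionic dual.

  The barycenters of states on the continuous functions on the dual form a compact convex set that
  contains the dual, so by the Krein-Milman theorem it contains \<open>P\<close>; a state is integration against
  a Radon measure by the Riesz-Markov theorem.
\<close>

section \<open>Compact convex sets in product spaces\<close>

instantiation "fun" :: (type, scaleR) scaleR
begin

definition "r *\<^sub>R f = (\<lambda>x. r *\<^sub>R f x)"

instance ..

end

lemma scaleR_fun_apply [simp]: "(r *\<^sub>R f) x = r *\<^sub>R f x"
  by (simp add: scaleR_fun_def)

instance "fun" :: (type, real_vector) real_vector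
  by standard (simp_all add: fun_eq_iff scaleR_add_left scaleR_add_right)

lemma compact_Pi_UNIV:
  fixes S :: "'a \<Rightarrow> 'b::topological_space set"
  assumes "\<And>x. compact (S x)"
  shows "compact (Pi UNIV S)"
proof -
  have "compactin (product_topology (\<lambda>_. euclidean) UNIV) (PiE UNIV S)"
    using assms by (simp add: compactin_PiE)
  then show ?thesis
    by (simp add: euclidean_product_topology PiE_UNIV_domain)
qed

lemma face_of_maximizers:
  fixes l :: "'a::real_vector \<Rightarrow> real"
  assumes "convex S" "linear l"
  shows "{p \<in> S. \<forall>q\<in>S. l q \<le> l p} face_of S"
  unfolding face_of_def
proof (intro conjI ballI impI)
  have "{p \<in> S. \<forall>q\<in>S. l q \<le> l p} = S \<inter> (\<Inter>q\<in>S. l -` {l q..})"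
    by auto
  then show "convex {p \<in> S. \<forall>q\<in>S. l q \<le> l p}"
    using assms by (auto intro!: convex_Int convex_INT convex_linear_vimage)
next
  fix a b x
  assume ab: "a \<in> S" "b \<in> S" and "x \<in> {p \<in> S. \<forall>q\<in>S. l q \<le> l p}" "x \<in> open_segment a b"
  then obtain u where u: "0 < u" "u < 1" and x: "x = (1 - u) *\<^sub>R a + u *\<^sub>R b"
    and max: "\<And>q. q \<in> S \<Longrightarrow> l q \<le> l x"
    by (auto simp: in_segment)
  have "l x = (1 - u) * l a + u * l b"
    unfolding x by (simp add: linear_add[OF assms(2)] linear_scale[OF assms(2)])
  then have "(1 - u) * (l x - l a) + u * (l x - l b) = 0"
    by (simp add: algebra_simps)
  moreover have "0 \<le> (1 - u) * (l x - l a)" "0 \<le> u * (l x - l b)"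
    using u ab max by auto
  ultimately have "l a = l x" "l b = l x"
    using u by (simp_all add: add_nonneg_eq_0_iff)
  then show "a \<in> {p \<in> S. \<forall>q\<in>S. l q \<le> l p}" "b \<in> {p \<in> S. \<forall>q\<in>S. l q \<le> l p}"
    using ab max by auto
qed auto

lemma closed_maximizers:
  fixes l :: "'a::topological_space \<Rightarrow> real"
  assumes "closed S" "continuous_on UNIV l"
  shows "closed {p \<in> S. \<forall>q\<in>S. l q \<le> l p}"
proof -
  have "{p \<in> S. \<forall>q\<in>S. l q \<le> l p} = S \<inter> (\<Inter>q\<in>S. {p. l q \<le> l p})"
    by auto
  then show ?thesis
    using assms by (auto intro!: closed_Int closed_INT closed_Collect_le continuous_on_const)
qed

lemma compact_Int_Inter_chain_nonempty:
  assumes K: "compact K" and chain: "subset.chain \<A> \<C>" "\<C> \<noteq> {}"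
    and \<C>: "\<And>C. C \<in> \<C> \<Longrightarrow> closed C" "\<And>C. C \<in> \<C> \<Longrightarrow> K \<inter> C \<noteq> {}"
  shows "K \<inter> \<Inter>\<C> \<noteq> {}"
proof (rule compact_imp_fip[OF K \<C>(1)])
  fix \<D> assume \<D>: "finite \<D>" "\<D> \<subseteq> \<C>"
  show "K \<inter> \<Inter>\<D> \<noteq> {}"
  proof (cases "\<D> = {}")
    case True
    then show ?thesis using \<C>(2) chain(2) by auto
  next
    case False
    moreover have "subset.chain \<A> \<D>"
      using chain(1) \<D>(2) by (meson subset_chain_def subset_trans subsetD)
    ultimately have "\<Inter>\<D> \<in> \<C>"
      using Inter_in_chain[OF \<D>(1)] \<D>(2) by blast
    then show ?thesis by (rule \<C>(2))
  qed
qed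

lemma minimal_closed_face:
  fixes K :: "'a::{real_vector,topological_space} set"
  assumes K: "compact K" and F: "F face_of K" "closed F" "F \<noteq> {}"
  obtains E where "E \<subseteq> F" "E face_of K" "closed E" "E \<noteq> {}"
    "\<And>D. D face_of K \<Longrightarrow> closed D \<Longrightarrow> D \<noteq> {} \<Longrightarrow> D \<subseteq> E \<Longrightarrow> D = E"
proof -
  define faces where "faces = {E. E face_of K \<and> closed E \<and> E \<noteq> {} \<and> E \<subseteq> F}"
  have "\<exists>E\<in>faces. \<forall>D\<in>faces. E \<supseteq> D \<longrightarrow> D = E"
  proof (rule predicate_Zorn)
    show "partial_order_on faces (relation_of (\<supseteq>) faces)"
      by (rule partial_order_on_relation_ofI) auto
    fix \<C> assume "\<C> \<in> Chains (relation_of (\<supseteq>) faces)"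
    then have chain: "subset.chain faces \<C>"
      by (auto simp: Chains_def relation_of_def subset_chain_def)
    show "\<exists>E\<in>faces. \<forall>D\<in>\<C>. D \<supseteq> E"
    proof (cases "\<C> = {}")
      case True
      then show ?thesis using F by (auto simp: faces_def)
    next
      case False
      have \<C>: "D face_of K" "closed D" "D \<noteq> {}" "D \<subseteq> F" if "D \<in> \<C>" for D
        using chain that by (auto simp: subset_chain_def faces_def)
      have "K \<inter> \<Inter>\<C> \<noteq> {}"
      proof (rule compact_Int_Inter_chain_nonempty[OF K chain False])
        show "K \<inter> D \<noteq> {}" if "D \<in> \<C>" for D
          using \<C>[OF that] face_of_imp_subset[of D K] by blast
      qed (use \<C> in blast)
      then have "\<Inter>\<C> \<in> faces"
        using face_of_Inter[OF False \<C>(1)] closed_Inter[of \<C>] \<C>(2,4) False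
        unfolding faces_def by blast
      then show ?thesis by blast
    qed
  qed
  then obtain E where "E \<in> faces" "\<And>D. D \<in> faces \<Longrightarrow> D \<subseteq> E \<Longrightarrow> D = E"
    by blast
  then show ?thesis
    by (intro that[of E]) (auto simp: faces_def)
qed

lemma extreme_point_attains_sup:
  fixes K :: "'a::{real_vector,topological_space} set" and l :: "'a \<Rightarrow> real"
  assumes K: "compact K" "closed K" "convex K" "K \<noteq> {}" and l: "linear l" "continuous_on UNIV l"
    and separating: "\<And>x y :: 'a.
      (\<And>h::'a \<Rightarrow> real. linear h \<Longrightarrow> continuous_on UNIV h \<Longrightarrow> h x = h y) \<Longrightarrow> x = y"
  obtains p where "p extreme_point_of K" "\<And>q. q \<in> K \<Longrightarrow> l q \<le> l p"
proof -
  let ?max = "\<lambda>h S. {p \<in> S. \<forall>q\<in>S. h q \<le> (h p :: real)}"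
  have max_face: "?max h F face_of K" "closed (?max h F)" "?max h F \<noteq> {}"
    if F: "F face_of K" "closed F" "F \<noteq> {}" and h: "linear h" "continuous_on UNIV h"
    for F and h :: "'a \<Rightarrow> real"
  proof -
    have "convex F" "compact F"
      using F K face_of_imp_subset[OF F(1)] compact_Int_closed[OF K(1) F(2)]
      by (auto simp: face_of_def inf.absorb2)
    show "?max h F face_of K"
      using face_of_trans[OF face_of_maximizers[OF \<open>convex F\<close> h(1)] F(1)] .
    show "closed (?max h F)"
      using F(2) h(2) by (rule closed_maximizers)
    show "?max h F \<noteq> {}"
      using continuous_attains_sup[OF \<open>compact F\<close> F(3), of h] continuous_on_subset[OF h(2)] by blast
  qed
  note max_K = max_face[OF face_of_refl[OF K(3)] K(2,4) l]
  obtain E where E: "E \<subseteq> ?max l K" "E face_of K" "closed E" "E \<noteq> {}"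
    and minimal: "\<And>D. D face_of K \<Longrightarrow> closed D \<Longrightarrow> D \<noteq> {} \<Longrightarrow> D \<subseteq> E \<Longrightarrow> D = E"
    by (rule minimal_closed_face[OF K(1) max_K], rule that)
  have le_on_E: "h p \<le> h q" if "p \<in> E" "q \<in> E" "linear h" "continuous_on UNIV h"
    for p q and h :: "'a \<Rightarrow> real"
  proof -
    have "?max h E = E"
      using that E by (intro minimal max_face) auto
    then show ?thesis using that by blast
  qed
  obtain p where "p \<in> E" using E(4) by blast
  then have "E = {p}"
    by (auto intro!: separating antisym le_on_E)
  then show ?thesis
    using E(1,2) face_of_singleton[of p K] by (intro that[of p]) auto
qed

lemma nonpos_if_small_quadratic_nonneg:
  fixes a b :: real
  assumes "\<And>t. 0 < t \<Longrightarrow> t < 1 \<Longrightarrow> 0 \<le> t\<^sup>2 * b - 2 * t * a"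
  shows "a \<le> 0"
proof -
  have "2 * a \<le> t * b" if "0 < t" "t < 1" for t
  proof -
    have "0 \<le> t * (t * b - 2 * a)"
      using assms[OF that] by (simp add: power2_eq_square algebra_simps)
    then show ?thesis using that by (simp add: zero_le_mult_iff)
  qed
  then have "\<forall>\<^sub>F t in at_right 0. 2 * a \<le> t * b"
    by (auto simp: eventually_at_right_field intro: exI[of _ 1])
  moreover have "((\<lambda>t. t * b) \<longlongrightarrow> 0 * b) (at_right 0)"
    by (intro tendsto_intros)
  ultimately have "2 * a \<le> 0 * b"
    by (intro tendsto_lowerbound) auto
  then show ?thesis by simp
qed

lemma linear_sum_inner:
  fixes v :: "'a \<Rightarrow> 'b::real_inner"
  shows "linear (\<lambda>f. \<Sum>x\<in>F. v x \<bullet> f x)"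
  by (rule linearI) (simp_all add: inner_add_right sum.distrib sum_distrib_left)

lemma continuous_on_sum_inner:
  fixes v :: "'a \<Rightarrow> 'b::real_inner"
  shows "continuous_on A (\<lambda>f. \<Sum>x\<in>F. v x \<bullet> f x)"
  by (intro continuous_intros continuous_on_subset[OF continuous_on_product_coordinates]) simp

lemma continuous_linear_functionals_separate_functions:
  fixes f g :: "'a \<Rightarrow> 'b::real_inner"
  assumes "\<And>h::('a \<Rightarrow> 'b) \<Rightarrow> real. linear h \<Longrightarrow> continuous_on UNIV h \<Longrightarrow> h f = h g"
  shows "f = g"
proof
  fix x
  have "v \<bullet> f x = v \<bullet> g x" for v
    using assms[OF linear_sum_inner continuous_on_sum_inner, of "\<lambda>_. v" "{x}"] by simp
  then show "f x = g x"
    using vector_eq_ldot by blast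
qed

lemma finite_coordinates_distinguish:
  fixes S :: "('a \<Rightarrow> 'b::t2_space) set"
  assumes "compact S" "p \<notin> S"
  shows "\<exists>F. finite F \<and> (\<forall>q\<in>S. \<exists>x\<in>F. q x \<noteq> p x)"
proof (rule ccontr)
  assume "\<not> ?thesis"
  then have agrees: "\<exists>q\<in>S. \<forall>x\<in>F. q x = p x" if "finite F" for F
    using that by simp
  have "S \<inter> (\<Inter>x\<in>F. {q. q x = p x}) \<noteq> {}" if F: "finite F" for F
  proof -
    obtain q where "q \<in> S" "\<And>x. x \<in> F \<Longrightarrow> q x = p x"
      using agrees[OF F] by auto
    then have "q \<in> S \<inter> (\<Inter>x\<in>F. {q. q x = p x})" by simp
    then show ?thesis by blast
  qed
  moreover have "closed {q. q x = p x}" for x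
    by (intro closed_Collect_eq continuous_on_product_coordinates continuous_on_const)
  ultimately have "S \<inter> (\<Inter>x. {q. q x = p x}) \<noteq> {}"
    by (rule compact_imp_fip_image[OF assms(1), rotated])
  then obtain q where "q \<in> S" "\<And>x. q x = p x" by auto
  then show False
    using assms(2) ext[of q p] by simp
qed

lemma any_closest_point_dot_sum:
  fixes S :: "('a \<Rightarrow> 'b::real_inner) set"
  assumes S: "convex S" "m \<in> S" "q \<in> S"
    and closest: "\<And>r. r \<in> S \<Longrightarrow> (\<Sum>x\<in>F. (norm (p x - m x))\<^sup>2) \<le> (\<Sum>x\<in>F. (norm (p x - r x))\<^sup>2)"
  shows "(\<Sum>x\<in>F. (p x - m x) \<bullet> (q x - m x)) \<le> 0"
proof (rule nonpos_if_small_quadratic_nonneg)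
  fix t :: real
  assume t: "0 < t" "t < 1"
  let ?r = "m + t *\<^sub>R (q - m)"
  have "(norm (p x - ?r x))\<^sup>2 =
      (norm (p x - m x))\<^sup>2 + t\<^sup>2 * (norm (q x - m x))\<^sup>2 - 2 * t * ((p x - m x) \<bullet> (q x - m x))" for x
  proof -
    have "p x - ?r x = (p x - m x) - t *\<^sub>R (q x - m x)"
      by simp
    then show ?thesis
      unfolding power2_norm_eq_inner by (simp only: inner_diff_left inner_diff_right)
        (simp add: inner_commute power2_eq_square algebra_simps)
  qed
  then have "(\<Sum>x\<in>F. (norm (p x - ?r x))\<^sup>2) = (\<Sum>x\<in>F. (norm (p x - m x))\<^sup>2)
      + t\<^sup>2 * (\<Sum>x\<in>F. (norm (q x - m x))\<^sup>2) - 2 * t * (\<Sum>x\<in>F. (p x - m x) \<bullet> (q x - m x))"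
    by (simp only: sum.distrib sum_subtractf sum_distrib_left)
  moreover have "?r \<in> S"
    using convexD_alt[OF S, of t] t by (simp add: algebra_simps)
  ultimately show "0 \<le> t\<^sup>2 * (\<Sum>x\<in>F. (norm (q x - m x))\<^sup>2)
      - 2 * t * (\<Sum>x\<in>F. (p x - m x) \<bullet> (q x - m x))"
    using closest[of ?r] by simp
qed

lemma compact_convex_separation:
  fixes S :: "('a \<Rightarrow> 'b::real_inner) set"
  assumes S: "compact S" "convex S" and p: "p \<notin> S"
  obtains l :: "('a \<Rightarrow> 'b) \<Rightarrow> real" where "linear l" "continuous_on UNIV l" "\<And>q. q \<in> S \<Longrightarrow> l q < l p"
proof (cases "S = {}")
  case True
  then show ?thesis
    using that[of "\<lambda>_. 0"] by (simp add: linear_zero)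
next
  case False
  obtain F where F: "finite F" "\<And>q. q \<in> S \<Longrightarrow> \<exists>x\<in>F. q x \<noteq> p x"
    using finite_coordinates_distinguish[OF S(1) p] by blast
  let ?d = "\<lambda>q. \<Sum>x\<in>F. (norm (p x - q x))\<^sup>2"
  have "continuous_on S ?d"
    by (intro continuous_intros continuous_on_subset[OF continuous_on_product_coordinates]) simp
  then obtain m where m: "m \<in> S" and nearest: "\<And>q. q \<in> S \<Longrightarrow> ?d m \<le> ?d q"
    using continuous_attains_inf[OF S(1) False] by blast
  define l where "l q = (\<Sum>x\<in>F. (p x - m x) \<bullet> q x)" for q
  have l: "linear l" "continuous_on UNIV l"
    unfolding l_def by (rule linear_sum_inner, rule continuous_on_sum_inner)
  have "l (q - m) \<le> 0" if "q \<in> S" for q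
    using any_closest_point_dot_sum[OF S(2) m that nearest] by (simp add: l_def)
  moreover have "0 < l (p - m)"
  proof -
    obtain x where "x \<in> F" "m x \<noteq> p x"
      using F(2)[OF m] by blast
    then have "0 < (\<Sum>x\<in>F. (p x - m x) \<bullet> (p x - m x))"
      using F(1) by (intro sum_pos2[of F x]) auto
    then show ?thesis by (simp add: l_def)
  qed
  ultimately show ?thesis
    using l by (intro that[OF l]) (fastforce simp: linear_diff)
qed

theorem compact_convex_subset_if_extreme_points:
  fixes K S :: "('a \<Rightarrow> 'b::real_inner) set"
  assumes K: "compact K" "closed K" "convex K" and S: "compact S" "convex S"
    and extreme: "\<And>p. p extreme_point_of K \<Longrightarrow> p \<in> S"
  shows "K \<subseteq> S"
proof
  fix p assume "p \<in> K"
  show "p \<in> S"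
  proof (rule ccontr)
    assume "p \<notin> S"
    then obtain l :: "('a \<Rightarrow> 'b) \<Rightarrow> real"
      where l: "linear l" "continuous_on UNIV l" "\<And>q. q \<in> S \<Longrightarrow> l q < l p"
      using compact_convex_separation[OF S] by metis
    have "K \<noteq> {}" using \<open>p \<in> K\<close> by blast
    then obtain q where "q extreme_point_of K" "\<And>r. r \<in> K \<Longrightarrow> l r \<le> l q"
      using extreme_point_attains_sup[OF K _ l(1,2)
          continuous_linear_functionals_separate_functions]
      by metis
    then show False
      using l(3)[OF extreme] \<open>p \<in> K\<close> by fastforce
  qed
qed

section \<open>The Riesz--Markov theorem on compact Hausdorff spaces\<close>

lemma measurable_radon_on_continuous_map:
  assumes "radon_on T M" "continuous_map T euclidean f"
  shows "f \<in> borel_measurable M"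
proof (rule borel_measurableI)
  fix S :: "'b set" assume "open S"
  then have "openin T {x \<in> topspace T. f x \<in> S}"
    using assms(2) openin_continuous_map_preimage[of T euclidean f S] by simp
  moreover have "f -` S \<inter> space M = {x \<in> topspace T. f x \<in> S}"
    using assms(1) by (auto simp: radon_on_def)
  ultimately show "f -` S \<inter> space M \<in> sets M"
    using assms(1) by (simp add: radon_on_def sigma_sets.Basic)
qed

lemma bounded_continuous_map_image:
  fixes f :: "'a \<Rightarrow> 'b::metric_space"
  assumes "compact_space T" "continuous_map T euclidean f"
  shows "bounded (f ` topspace T)"
proof -
  have "compactin euclidean (f ` topspace T)"
    using image_compactin[OF _ assms(2)] assms(1) by (simp add: compact_space_def)
  then show ?thesis by (simp add: compact_imp_bounded)
qed

lemma integrable_radon_on_continuous_map: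
  fixes f :: "'a \<Rightarrow> 'b::{banach,second_countable_topology}"
  assumes "finite_measure M" "radon_on T M" "compact_space T" "continuous_map T euclidean f"
  shows "integrable M f"
proof -
  obtain b where "norm (f x) \<le> b" if "x \<in> topspace T" for x
    using bounded_continuous_map_image[OF assms(3,4)] by (auto simp: bounded_iff)
  then show ?thesis
    using assms(2) measurable_radon_on_continuous_map[OF assms(2,4)]
    by (intro finite_measure.integrable_const_bound[OF assms(1), of _ b] AE_I2)
      (auto simp: radon_on_def)
qed

locale closed_content =
  fixes T :: "'a topology" and \<kappa> :: "'a set \<Rightarrow> ennreal"
  assumes compact: "compact_space T" and Hausdorff: "Hausdorff_space T"
    and content_finite: "\<kappa> (topspace T) < \<infinity>"
    and content_mono: "closedin T C \<Longrightarrow> closedin T D \<Longrightarrow> C \<subseteq> D \<Longrightarrow> \<kappa> C \<le> \<kappa> D"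
    and content_subadditive: "closedin T C \<Longrightarrow> closedin T D \<Longrightarrow> \<kappa> (C \<union> D) \<le> \<kappa> C + \<kappa> D"
    and content_superadditive: "closedin T C \<Longrightarrow> closedin T D \<Longrightarrow> disjnt C D \<Longrightarrow> \<kappa> C + \<kappa> D \<le> \<kappa> (C \<union> D)"
begin

definition inner_content :: "'a set \<Rightarrow> ennreal" where
  "inner_content U = (SUP C\<in>{C. closedin T C \<and> C \<subseteq> U}. \<kappa> C)"

definition outer_content :: "'a set \<Rightarrow> ennreal" where
  "outer_content A = (INF U\<in>{U. openin T U \<and> A \<subseteq> U}. inner_content U)"

lemma content_le_inner_content: "closedin T C \<Longrightarrow> C \<subseteq> U \<Longrightarrow> \<kappa> C \<le> inner_content U"
  unfolding inner_content_def by (rule SUP_upper) simp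

lemma inner_content_leI: "(\<And>C. closedin T C \<Longrightarrow> C \<subseteq> U \<Longrightarrow> \<kappa> C \<le> r) \<Longrightarrow> inner_content U \<le> r"
  unfolding inner_content_def by (rule SUP_least) simp

lemma inner_content_mono: "U \<subseteq> V \<Longrightarrow> inner_content U \<le> inner_content V"
  by (intro inner_content_leI content_le_inner_content) auto

lemma inner_content_space: "inner_content (topspace T) = \<kappa> (topspace T)"
  by (intro antisym inner_content_leI content_le_inner_content content_mono) auto

lemma content_empty: "\<kappa> {} = 0"
proof -
  have "\<kappa> {} + \<kappa> {} \<le> \<kappa> {} + 0"
    using content_superadditive[of "{}" "{}"] by simp
  moreover have "\<kappa> {} < \<infinity>"
    using content_mono[of "{}" "topspace T"] content_finite by (auto intro: le_less_trans)
  ultimately show ?thesis by (auto simp: ennreal_add_left_cancel_le)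
qed

lemma inner_content_empty: "inner_content {} = 0"
  using inner_content_leI[of "{}" 0] by (auto simp: content_empty)

lemma inner_content_Un:
  assumes U: "openin T U" and V: "openin T V"
  shows "inner_content (U \<union> V) \<le> inner_content U + inner_content V"
proof (rule inner_content_leI)
  fix C assume C: "closedin T C" "C \<subseteq> U \<union> V"
  have "normal_space T"
    using compact Hausdorff compact_Hausdorff_or_regular_imp_normal_space by blast
  moreover have "closedin T (C - U)" "closedin T (C - V)" "disjnt (C - U) (C - V)"
    using C U V by (auto simp: disjnt_def)
  ultimately obtain A B where AB: "openin T A" "openin T B" "C - U \<subseteq> A" "C - V \<subseteq> B" "disjnt A B"
    unfolding normal_space_def by metis
  then have "(C - A) \<union> (C - B) = C"
    by (auto simp: disjnt_def)
  then have "\<kappa> C \<le> \<kappa> (C - A) + \<kappa> (C - B)"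
    using content_subadditive[of "C - A" "C - B"] AB(1,2) C(1) by (simp add: closedin_diff)
  also have "\<dots> \<le> inner_content U + inner_content V"
    using AB C by (intro add_mono content_le_inner_content) auto
  finally show "\<kappa> C \<le> inner_content U + inner_content V" .
qed

lemma inner_content_finite_UN:
  assumes "finite I" "\<And>i. i \<in> I \<Longrightarrow> openin T (U i)"
  shows "inner_content (\<Union>i\<in>I. U i) \<le> (\<Sum>i\<in>I. inner_content (U i))"
  using assms
proof (induction I rule: finite_induct)
  case (insert i I)
  have "inner_content (\<Union>i\<in>insert i I. U i) \<le> inner_content (U i) + inner_content (\<Union>i\<in>I. U i)"
    using insert.prems inner_content_Un[of "U i" "\<Union>i\<in>I. U i"] by auto
  also have "\<dots> \<le> inner_content (U i) + (\<Sum>i\<in>I. inner_content (U i))"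
    using insert by (intro add_left_mono) auto
  finally show ?case using insert.hyps by simp
qed (simp add: inner_content_empty)

lemma inner_content_UN:
  fixes U :: "nat \<Rightarrow> 'a set"
  assumes "\<And>i. openin T (U i)"
  shows "inner_content (\<Union>i. U i) \<le> (\<Sum>i. inner_content (U i))"
proof (rule inner_content_leI)
  fix C assume C: "closedin T C" "C \<subseteq> (\<Union>i. U i)"
  then have "compactin T C" using closedin_compact_space[OF compact] by blast
  then obtain \<F> where \<F>: "finite \<F>" "\<F> \<subseteq> range U" "C \<subseteq> \<Union>\<F>"
    using compactinD[of T C "range U"] C(2) assms by blast
  then obtain I where I: "finite I" "\<F> = U ` I" by (meson finite_subset_image)
  have "\<kappa> C \<le> inner_content (\<Union>i\<in>I. U i)"
    using C \<F> I by (intro content_le_inner_content) auto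
  also have "\<dots> \<le> (\<Sum>i\<in>I. inner_content (U i))"
    using I assms by (intro inner_content_finite_UN) auto
  also have "\<dots> \<le> (\<Sum>i. inner_content (U i))"
    using I by (intro sum_le_suminf) auto
  finally show "\<kappa> C \<le> (\<Sum>i. inner_content (U i))" .
qed

lemma outer_content_le: "openin T U \<Longrightarrow> A \<subseteq> U \<Longrightarrow> outer_content A \<le> inner_content U"
  unfolding outer_content_def by (rule INF_lower) simp

lemma outer_content_open: "openin T U \<Longrightarrow> outer_content U = inner_content U"
  by (intro antisym outer_content_le order_refl)
    (auto simp: outer_content_def intro: INF_greatest inner_content_mono)

lemma outer_content_mono: "A \<subseteq> B \<Longrightarrow> outer_content A \<le> outer_content B"
  unfolding outer_content_def by (rule INF_superset_mono) auto

lemma outer_content_finite: "A \<subseteq> topspace T \<Longrightarrow> outer_content A < \<infinity>"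
  using outer_content_le[of "topspace T" A] content_finite
  by (auto simp: inner_content_space intro: le_less_trans)

lemma outer_content_UN:
  fixes A :: "nat \<Rightarrow> 'a set"
  assumes "\<And>i. A i \<subseteq> topspace T"
  shows "outer_content (\<Union>i. A i) \<le> (\<Sum>i. outer_content (A i))"
proof (rule ennreal_le_epsilon)
  fix e :: real assume e: "0 < e"
  have "\<exists>U. openin T U \<and> A i \<subseteq> U \<and> inner_content U < outer_content (A i) + e * (1/2)^Suc i" for i
  proof -
    have "outer_content (A i) < outer_content (A i) + e * (1/2)^Suc i"
      using outer_content_finite[OF assms, of i] e
      by (simp add: ennreal_zero_less_mult_iff less_top)
    then show ?thesis by (subst (asm) outer_content_def) (auto simp: INF_less_iff)
  qed
  then obtain U where U: "\<And>i. openin T (U i)" "\<And>i. A i \<subseteq> U i"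
      "\<And>i. inner_content (U i) < outer_content (A i) + e * (1/2)^Suc i" by metis
  have "outer_content (\<Union>i. A i) \<le> inner_content (\<Union>i. U i)"
    using U(1,2) by (intro outer_content_le) auto
  also have "\<dots> \<le> (\<Sum>i. inner_content (U i))" by (rule inner_content_UN[OF U(1)])
  also have "\<dots> \<le> (\<Sum>i. outer_content (A i) + e * (1/2)^Suc i)"
    using U(3) by (intro suminf_le) (auto simp: less_imp_le)
  also have "\<dots> = (\<Sum>i. outer_content (A i)) + (\<Sum>i. ennreal e * ennreal ((1/2) ^ Suc i))"
    using e by (subst suminf_add[symmetric])
      (auto simp del: ennreal_suminf_cmult simp add: ennreal_mult[symmetric])
  also have "\<dots> = (\<Sum>i. outer_content (A i)) + e"
    unfolding ennreal_suminf_cmult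
    by (subst suminf_ennreal_eq[OF zero_le_power power_half_series]) auto
  finally show "outer_content (\<Union>i. A i) \<le> (\<Sum>i. outer_content (A i)) + e" .
qed

lemma outer_measure_space_outer_content: "outer_measure_space (Pow (topspace T)) outer_content"
  unfolding outer_measure_space_def
proof (intro conjI)
  show "positive (Pow (topspace T)) outer_content"
    by (simp add: positive_def outer_content_open inner_content_empty)
  show "increasing (Pow (topspace T)) outer_content"
    by (simp add: increasing_def outer_content_mono)
  show "countably_subadditive (Pow (topspace T)) outer_content"
    unfolding countably_subadditive_def by (auto intro!: outer_content_UN)
qed

lemma content_add_inner_content_Diff_le:
  assumes C: "closedin T C" "C \<subseteq> U"
  shows "\<kappa> C + inner_content (U - C) \<le> inner_content U"
proof -
  have "\<kappa> C + \<kappa> D \<le> inner_content U" if D: "closedin T D" "D \<subseteq> U - C" for D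
  proof -
    have "\<kappa> C + \<kappa> D \<le> \<kappa> (C \<union> D)"
      using C D by (intro content_superadditive) (auto simp: disjnt_def)
    also have "\<dots> \<le> inner_content U"
      using C D by (intro content_le_inner_content) auto
    finally show ?thesis .
  qed
  moreover have "{D. closedin T D \<and> D \<subseteq> U - C} \<noteq> {}" by (auto intro: exI[of _ "{}"])
  ultimately show ?thesis
    unfolding inner_content_def[of "U - C"]
    by (subst ennreal_SUP_add_right) (auto intro!: SUP_least)
qed

lemma outer_content_split_open_le:
  assumes V: "openin T V"
  shows "outer_content (A \<inter> V) + outer_content (A - V) \<le> outer_content A"
  unfolding outer_content_def[of A]
proof (rule INF_greatest)
  fix U assume "U \<in> {U. openin T U \<and> A \<subseteq> U}"
  then have U: "openin T U" "A \<subseteq> U" by auto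
  have "\<kappa> C + outer_content (A - V) \<le> inner_content U"
    if C: "closedin T C" "C \<subseteq> U \<inter> V" for C
  proof -
    have "\<kappa> C + outer_content (A - V) \<le> \<kappa> C + inner_content (U - C)"
      using U C by (intro add_left_mono outer_content_le) auto
    also have "\<dots> \<le> inner_content U"
      using C by (intro content_add_inner_content_Diff_le) auto
    finally show ?thesis .
  qed
  moreover have "{C. closedin T C \<and> C \<subseteq> U \<inter> V} \<noteq> {}" by (auto intro: exI[of _ "{}"])
  ultimately have "inner_content (U \<inter> V) + outer_content (A - V) \<le> inner_content U"
    unfolding inner_content_def[of "U \<inter> V"]
    by (subst ennreal_SUP_add_left[symmetric]) (auto intro!: SUP_least)
  moreover have "outer_content (A \<inter> V) \<le> inner_content (U \<inter> V)"
    using U V by (intro outer_content_le) auto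
  ultimately show "outer_content (A \<inter> V) + outer_content (A - V) \<le> inner_content U"
    by (rule order_trans[OF add_right_mono, rotated])
qed

lemma outer_content_Un_le:
  assumes "A \<subseteq> topspace T" "B \<subseteq> topspace T" "A \<inter> B = {}"
  shows "outer_content (A \<union> B) \<le> outer_content A + outer_content B"
proof -
  have "subadditive (Pow (topspace T)) outer_content"
    using outer_measure_space_outer_content unfolding outer_measure_space_def
    by (intro ring_of_sets.countably_subadditive_subadditive[OF ring_of_sets_Pow]) auto
  then show ?thesis using assms by (simp add: subadditive_def)
qed

lemma openin_lambda_system:
  assumes V: "openin T V"
  shows "V \<in> lambda_system (topspace T) (Pow (topspace T)) outer_content"
proof -
  have "outer_content (A \<inter> V) + outer_content (A - V) = outer_content A" if "A \<subseteq> topspace T" for A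
  proof (rule antisym[OF outer_content_split_open_le[OF V]])
    show "outer_content A \<le> outer_content (A \<inter> V) + outer_content (A - V)"
      using outer_content_Un_le[of "A \<inter> V" "A - V"] that by (fastforce simp: Int_Diff_Un)
  qed
  then show ?thesis
    using openin_subset[OF V] by (simp add: algebra.lambda_system_eq[OF algebra_Pow])
qed

text \<open>Since \<open>\<kappa>\<close> need not be outer regular, this measure may exceed \<open>\<kappa>\<close> on closed sets.\<close>

definition content_measure :: "'a measure" where
  "content_measure = measure_of (topspace T) {U. openin T U} outer_content"

lemma space_content_measure: "space content_measure = topspace T"
  unfolding content_measure_def by (rule space_measure_of) (auto dest: openin_subset)

lemma sets_content_measure: "sets content_measure = sigma_sets (topspace T) {U. openin T U}"
  unfolding content_measure_def by (rule sets_measure_of) (auto dest: openin_subset)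

lemma openin_sets_content_measure: "openin T U \<Longrightarrow> U \<in> sets content_measure"
  by (simp add: sets_content_measure sigma_sets.Basic)

lemma closedin_sets_content_measure: "closedin T C \<Longrightarrow> C \<in> sets content_measure"
  using sets.compl_sets[OF openin_sets_content_measure, of "topspace T - C"]
  by (simp add: space_content_measure closedin_def double_diff)

lemma emeasure_content_measure:
  assumes "A \<in> sets content_measure"
  shows "emeasure content_measure A = outer_content A"
proof -
  let ?S = "lambda_system (topspace T) (Pow (topspace T)) outer_content"
  have measure_space: "measure_space (topspace T) ?S outer_content"
    using sigma_algebra.caratheodory_lemma[OF sigma_algebra_Pow outer_measure_space_outer_content] .
  then interpret S: sigma_algebra "topspace T" ?S by (simp add: measure_space_def)
  have sets_subset: "sets content_measure \<subseteq> ?S"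
    unfolding sets_content_measure by (intro S.sigma_sets_subset) (auto intro: openin_lambda_system)
  show ?thesis
  proof (rule emeasure_measure_of[OF content_measure_def])
    show "{U. openin T U} \<subseteq> Pow (topspace T)" by (auto dest: openin_subset)
    show "positive (sets content_measure) outer_content"
      by (simp add: positive_def outer_content_open inner_content_empty)
    show "countably_additive (sets content_measure) outer_content"
      using measure_space sets_subset unfolding measure_space_def countably_additive_def
      by (meson subset_trans subset_eq)
    show "A \<in> sets content_measure" by fact
  qed
qed

lemma emeasure_content_measure_open: "openin T U \<Longrightarrow> emeasure content_measure U = inner_content U"
  by (simp add: emeasure_content_measure openin_sets_content_measure outer_content_open)

lemma content_le_emeasure: "closedin T C \<Longrightarrow> \<kappa> C \<le> emeasure content_measure C"
  unfolding emeasure_content_measure[OF closedin_sets_content_measure] outer_content_def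
  by (intro INF_greatest content_le_inner_content) auto

lemma emeasure_content_measure_space: "emeasure content_measure (topspace T) = \<kappa> (topspace T)"
  by (simp add: emeasure_content_measure_open inner_content_space)

lemma finite_measure_content_measure: "finite_measure content_measure"
  using content_finite
  by (intro finite_measureI) (simp add: space_content_measure emeasure_content_measure_space)

lemma radon_on_content_measure: "radon_on T content_measure"
  unfolding radon_on_def
proof (intro conjI ballI allI impI)
  show "space content_measure = topspace T" by (rule space_content_measure)
  show "sets content_measure = sigma_sets (topspace T) {U. openin T U}"
    by (rule sets_content_measure)
  show "emeasure content_measure A = (INF U\<in>{U. openin T U \<and> A \<subseteq> U}. emeasure content_measure U)"
    if "A \<in> sets content_measure" for A
    unfolding emeasure_content_measure[OF that] outer_content_def
    by (intro INF_cong refl) (simp add: emeasure_content_measure_open)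
  fix U assume U: "openin T U"
  let ?sup = "SUP K\<in>{K. compactin T K \<and> K \<subseteq> U}. emeasure content_measure K"
  show "emeasure content_measure U = ?sup"
  proof (rule antisym)
    have "\<kappa> C \<le> ?sup" if C: "closedin T C" "C \<subseteq> U" for C
    proof -
      have "\<kappa> C \<le> emeasure content_measure C" by (rule content_le_emeasure[OF C(1)])
      also have "\<dots> \<le> ?sup"
        using C closedin_compact_space[OF compact] by (intro SUP_upper) auto
      finally show ?thesis .
    qed
    then show "emeasure content_measure U \<le> ?sup"
      unfolding emeasure_content_measure_open[OF U] by (rule inner_content_leI)
    show "?sup \<le> emeasure content_measure U"
      using U by (intro SUP_least emeasure_mono openin_sets_content_measure) auto
  qed
qed

end

locale positive_functional =
  fixes T :: "'a topology" and L :: "('a \<Rightarrow> real) \<Rightarrow> real"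
  assumes add: "continuous_map T euclideanreal f \<Longrightarrow> continuous_map T euclideanreal g \<Longrightarrow>
      L (\<lambda>x. f x + g x) = L f + L g"
    and scale: "continuous_map T euclideanreal f \<Longrightarrow> L (\<lambda>x. c * f x) = c * L f"
    and nonneg: "continuous_map T euclideanreal f \<Longrightarrow> (\<And>x. x \<in> topspace T \<Longrightarrow> 0 \<le> f x) \<Longrightarrow> 0 \<le> L f"
begin

lemma const: "L (\<lambda>_. c) = c * L (\<lambda>_. 1)"
  using scale[of "\<lambda>_. 1" c] by simp

lemma diff:
  assumes "continuous_map T euclideanreal f" "continuous_map T euclideanreal g"
  shows "L (\<lambda>x. f x - g x) = L f - L g"
  using add[OF assms(1) continuous_map_real_mult_left[OF assms(2)], of "- 1"]
    scale[OF assms(2), of "- 1"]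
  by simp

lemma mono:
  assumes "continuous_map T euclideanreal f" "continuous_map T euclideanreal g"
    and "\<And>x. x \<in> topspace T \<Longrightarrow> f x \<le> g x"
  shows "L f \<le> L g"
  using nonneg[OF continuous_map_diff[OF assms(2,1)]] assms(3) by (simp add: diff[OF assms(2,1)])

lemma cong:
  assumes "continuous_map T euclideanreal f" "\<And>x. x \<in> topspace T \<Longrightarrow> f x = g x"
  shows "L f = L g"
proof -
  have "continuous_map T euclideanreal g" using assms by (rule continuous_map_eq)
  then show ?thesis using assms by (intro antisym mono) auto
qed

lemma sum:
  assumes "finite I" "\<And>i. i \<in> I \<Longrightarrow> continuous_map T euclideanreal (f i)"
  shows "L (\<lambda>x. \<Sum>i\<in>I. f i x) = (\<Sum>i\<in>I. L (f i))"
  using assms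
proof (induction I rule: finite_induct)
  case (insert i I)
  then show ?case
    using add[of "f i" "\<lambda>x. \<Sum>i\<in>I. f i x"] by (simp add: continuous_map_sum)
qed (simp add: const[of 0])

lemma abs_le:
  assumes "continuous_map T euclideanreal f" "\<And>x. x \<in> topspace T \<Longrightarrow> \<bar>f x\<bar> \<le> b"
  shows "\<bar>L f\<bar> \<le> b * L (\<lambda>_. 1)"
proof -
  have "L f \<le> L (\<lambda>_. b)" "L (\<lambda>_. - b) \<le> L f"
    using assms by (auto intro!: mono simp: abs_le_iff minus_le_iff)
  then show ?thesis by (simp add: const[of b] const[of "- b"])
qed

end

lemma ennreal_le_INF_add_INF:
  fixes f :: "'a \<Rightarrow> ennreal" and g :: "'b \<Rightarrow> ennreal"
  assumes "\<And>i j. i \<in> I \<Longrightarrow> j \<in> J \<Longrightarrow> c \<le> f i + g j" "c < \<infinity>"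
  shows "c \<le> (INF i\<in>I. f i) + (INF j\<in>J. g j)"
proof -
  have "c - f i \<le> (INF j\<in>J. g j)" if "i \<in> I" for i
    using assms that by (intro INF_greatest) (auto simp: ennreal_minus_le_iff)
  then have "c - (INF j\<in>J. g j) \<le> (INF i\<in>I. f i)"
    using assms(2) by (intro INF_greatest) (auto simp: ennreal_minus_le_iff add.commute)
  then show ?thesis
    by (simp add: ennreal_minus_le_iff add.commute)
qed

lemma sum_unit_truncations:
  fixes y :: real
  assumes "0 \<le> y"
  shows "(\<Sum>k<n. max 0 (min 1 (y - real k))) = min y (real n)"
  using assms by (induction n) (auto simp: min_def max_def)

locale compact_positive_functional = positive_functional +
  assumes compact: "compact_space T" and Hausdorff: "Hausdorff_space T"
begin

definition continuous_majorants :: "'a set \<Rightarrow> ('a \<Rightarrow> real) set" where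
  "continuous_majorants C =
     {f. continuous_map T euclideanreal f \<and> (\<forall>x\<in>topspace T. indicat_real C x \<le> f x)}"

definition functional_content :: "'a set \<Rightarrow> ennreal" where
  "functional_content C = (INF f\<in>continuous_majorants C. ennreal (L f))"

lemma continuous_map_majorant: "f \<in> continuous_majorants C \<Longrightarrow> continuous_map T euclideanreal f"
  by (simp add: continuous_majorants_def)

lemma majorant_nonneg: "f \<in> continuous_majorants C \<Longrightarrow> x \<in> topspace T \<Longrightarrow> 0 \<le> f x"
  by (auto simp: continuous_majorants_def intro: order_trans[OF indicator_pos_le])

lemma majorant_ge_1: "f \<in> continuous_majorants C \<Longrightarrow> x \<in> topspace T \<Longrightarrow> x \<in> C \<Longrightarrow> 1 \<le> f x"
  by (auto simp: continuous_majorants_def indicator_def)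

lemma continuous_majorantsI:
  assumes "continuous_map T euclideanreal f" "\<And>x. x \<in> topspace T \<Longrightarrow> 0 \<le> f x"
    and "\<And>x. x \<in> topspace T \<Longrightarrow> x \<in> C \<Longrightarrow> 1 \<le> f x"
  shows "f \<in> continuous_majorants C"
  using assms by (simp add: continuous_majorants_def indicator_def)

lemma functional_majorant_nonneg: "f \<in> continuous_majorants C \<Longrightarrow> 0 \<le> L f"
  by (intro nonneg continuous_map_majorant majorant_nonneg)

lemma functional_content_le: "f \<in> continuous_majorants C \<Longrightarrow> functional_content C \<le> ennreal (L f)"
  unfolding functional_content_def by (rule INF_lower)

lemma functional_content_geI:
  "(\<And>f. f \<in> continuous_majorants C \<Longrightarrow> r \<le> ennreal (L f)) \<Longrightarrow> r \<le> functional_content C"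
  unfolding functional_content_def by (rule INF_greatest)

lemma functional_content_mono: "C \<subseteq> D \<Longrightarrow> functional_content C \<le> functional_content D"
  by (intro functional_content_geI functional_content_le continuous_majorantsI)
    (auto intro: continuous_map_majorant majorant_nonneg majorant_ge_1)

lemma one_in_continuous_majorants: "(\<lambda>_. 1) \<in> continuous_majorants C"
  by (intro continuous_majorantsI) auto

lemma functional_content_space: "functional_content (topspace T) = ennreal (L (\<lambda>_. 1))"
proof (rule antisym)
  show "ennreal (L (\<lambda>_. 1)) \<le> functional_content (topspace T)"
    by (intro functional_content_geI ennreal_leI mono)
      (auto intro: continuous_map_majorant majorant_ge_1)
qed (intro functional_content_le one_in_continuous_majorants)

lemma functional_content_Un_le:
  "functional_content (C \<union> D) \<le> functional_content C + functional_content D"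
  unfolding functional_content_def[of C] functional_content_def[of D]
proof (rule ennreal_le_INF_add_INF)
  fix f g
  assume fg: "f \<in> continuous_majorants C" "g \<in> continuous_majorants D"
  have "(\<lambda>x. f x + g x) \<in> continuous_majorants (C \<union> D)"
    using fg by (intro continuous_majorantsI)
      (auto intro: continuous_map_add continuous_map_majorant majorant_nonneg
        add_increasing add_increasing2 majorant_ge_1)
  then have "functional_content (C \<union> D) \<le> ennreal (L (\<lambda>x. f x + g x))"
    by (rule functional_content_le)
  then show "functional_content (C \<union> D) \<le> ennreal (L f) + ennreal (L g)"
    using fg
    by (simp add: add[OF fg[THEN continuous_map_majorant]] ennreal_plus functional_majorant_nonneg)
next
  show "functional_content (C \<union> D) < \<infinity>"
    using functional_content_le[OF one_in_continuous_majorants] by (rule le_less_trans) simp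
qed

lemma functional_content_Un_disjoint:
  assumes "closedin T C" "closedin T D" "disjnt C D"
  shows "functional_content C + functional_content D \<le> functional_content (C \<union> D)"
proof (rule functional_content_geI)
  fix h
  assume h: "h \<in> continuous_majorants (C \<union> D)"
  have "normal_space T"
    using compact Hausdorff compact_Hausdorff_or_regular_imp_normal_space by blast
  then obtain f where "continuous_map T (top_of_set {0..1::real}) f" "f ` C \<subseteq> {0}" "f ` D \<subseteq> {1}"
    using Urysohn_lemma[OF _ assms, of 0 1] by auto
  then have f: "continuous_map T euclideanreal f" "\<And>x. x \<in> topspace T \<Longrightarrow> 0 \<le> f x \<and> f x \<le> 1"
      "\<And>x. x \<in> C \<Longrightarrow> f x = 0" "\<And>x. x \<in> D \<Longrightarrow> f x = 1"
    by (auto simp: continuous_map_in_subtopology)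
  have majorants: "(\<lambda>x. (1 - f x) * h x) \<in> continuous_majorants C"
      "(\<lambda>x. f x * h x) \<in> continuous_majorants D"
    using f majorant_nonneg[OF h] majorant_ge_1[OF h]
    by (auto intro!: continuous_majorantsI continuous_intros continuous_map_majorant[OF h])
  then have "functional_content C + functional_content D
      \<le> ennreal (L (\<lambda>x. (1 - f x) * h x)) + ennreal (L (\<lambda>x. f x * h x))"
    by (intro add_mono functional_content_le)
  also have "\<dots> = ennreal (L (\<lambda>x. (1 - f x) * h x) + L (\<lambda>x. f x * h x))"
    using majorants by (intro ennreal_plus[symmetric] functional_majorant_nonneg)
  also have "L (\<lambda>x. (1 - f x) * h x) + L (\<lambda>x. f x * h x) = L h"
    unfolding add[OF majorants[THEN continuous_map_majorant], symmetric]
    by (simp add: algebra_simps)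
  finally show "functional_content C + functional_content D \<le> ennreal (L h)" .
qed

sublocale closed_content T functional_content
  using compact Hausdorff functional_content_mono functional_content_Un_le
    functional_content_Un_disjoint
  by unfold_locales (auto simp: functional_content_space)

lemma measure_content_measure_space: "measure content_measure (topspace T) = L (\<lambda>_. 1)"
  by (simp add: measure_def emeasure_content_measure_space functional_content_space nonneg)

lemma measure_content_measure_le:
  assumes "openin T U" "f \<in> continuous_majorants U"
  shows "measure content_measure U \<le> L f"
proof -
  have "functional_content C \<le> ennreal (L f)" if "C \<subseteq> U" for C
    using functional_content_mono[OF that] functional_content_le[OF assms(2)] by (rule order_trans)
  then have "emeasure content_measure U \<le> ennreal (L f)"
    unfolding emeasure_content_measure_open[OF assms(1)] by (intro inner_content_leI)
  then show ?thesis
    using functional_majorant_nonneg[OF assms(2)] by (simp add: measure_def enn2real_leI)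
qed

lemmas integrable_content_measure = integrable_radon_on_continuous_map
  [OF finite_measure_content_measure radon_on_content_measure compact]

lemma integral_content_measure_le_measure:
  assumes U: "openin T U" and f: "continuous_map T euclideanreal f"
    and le: "\<And>x. x \<in> topspace T \<Longrightarrow> f x \<le> indicat_real U x"
  shows "(\<integral>x. f x \<partial>content_measure) \<le> measure content_measure U"
proof -
  have "integrable content_measure (indicat_real U)"
    using openin_sets_content_measure[OF U]
      finite_measure.emeasure_finite[OF finite_measure_content_measure]
    by (simp add: less_top[symmetric])
  then have "(\<integral>x. f x \<partial>content_measure) \<le> (\<integral>x. indicat_real U x \<partial>content_measure)"
    using le
    by (intro integral_mono integrable_content_measure[OF f]) (simp_all add: space_content_measure)
  then show ?thesis
    using openin_sets_content_measure[OF U] by simp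
qed

lemma integral_content_measure_le:
  assumes f: "continuous_map T euclideanreal f" "\<And>x. x \<in> topspace T \<Longrightarrow> 0 \<le> f x \<and> f x \<le> 1"
  shows "(\<integral>x. f x \<partial>content_measure) \<le> L f"
proof (rule ccontr)
  assume "\<not> ?thesis"
  then obtain n :: nat where n: "L (\<lambda>_. 1) < real n * ((\<integral>x. f x \<partial>content_measure) - L f)"
    using reals_Archimedean3[of "(\<integral>x. f x \<partial>content_measure) - L f"] by auto
  txt \<open>The parts \<open>h k\<close> of \<open>n f\<close> in the bands \<open>[k, k + 1]\<close> add up to \<open>n f\<close>, and \<open>h k\<close> lies
    between the indicators of \<open>U (k + 1)\<close> and \<open>U k\<close>.\<close>
  define U where "U k = {x \<in> topspace T. real k < real n * f x}" for k
  define h where "h k x = max 0 (min 1 (real n * f x - real k))" for k x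
  have U: "openin T (U k)" for k
    using openin_continuous_map_preimage[of T euclideanreal "\<lambda>x. real n * f x" "{real k<..}"] f(1)
    by (simp add: U_def continuous_map_real_mult_left)
  have h: "continuous_map T euclideanreal (h k)" for k
    unfolding h_def using f(1) by (intro continuous_intros) auto
  have sum_h: "(\<Sum>k<n. h k x) = real n * f x" if "x \<in> topspace T" for x
    using f(2)[OF that] by (simp add: h_def sum_unit_truncations mult_left_le)
  have "real n * (\<integral>x. f x \<partial>content_measure) = (\<integral>x. (\<Sum>k<n. h k x) \<partial>content_measure)"
    unfolding integral_mult_right_zero[symmetric]
    by (intro Bochner_Integration.integral_cong) (auto simp: sum_h space_content_measure)
  also have "\<dots> = (\<Sum>k<n. \<integral>x. h k x \<partial>content_measure)"
    by (intro Bochner_Integration.integral_sum integrable_content_measure h)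
  also have "\<dots> \<le> (\<Sum>k<n. measure content_measure (U k))"
    by (intro sum_mono integral_content_measure_le_measure U h)
      (auto simp: h_def U_def indicator_def)
  also have "\<dots> \<le> (\<Sum>k<Suc n. measure content_measure (U k))"
    by simp
  also have "\<dots> = measure content_measure (U 0) + (\<Sum>k<n. measure content_measure (U (Suc k)))"
    by (rule sum.lessThan_Suc_shift)
  also have "\<dots> \<le> L (\<lambda>_. 1) + (\<Sum>k<n. L (h k))"
    by (intro add_mono sum_mono measure_content_measure_le U continuous_majorantsI h)
      (auto simp: h_def U_def)
  also have "(\<Sum>k<n. L (h k)) = L (\<lambda>x. \<Sum>k<n. h k x)"
    by (intro sum[symmetric] h) simp
  also have "\<dots> = real n * L f"
    unfolding scale[OF f(1), symmetric]
    using h by (intro cong continuous_map_sum) (auto simp: sum_h)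
  finally show False using n by (simp add: algebra_simps)
qed

theorem integral_content_measure:
  assumes f: "continuous_map T euclideanreal f"
  shows "(\<integral>x. f x \<partial>content_measure) = L f"
proof -
  have unit: "(\<integral>x. h x \<partial>content_measure) = L h"
    if h: "continuous_map T euclideanreal h" "\<And>x. x \<in> topspace T \<Longrightarrow> 0 \<le> h x \<and> h x \<le> 1" for h
  proof (rule antisym[OF integral_content_measure_le[OF h]])
    have "(\<integral>x. 1 - h x \<partial>content_measure) \<le> L (\<lambda>x. 1 - h x)"
      using h by (intro integral_content_measure_le continuous_intros) auto
    then show "L h \<le> (\<integral>x. h x \<partial>content_measure)"
      using integrable_content_measure[OF h(1)] diff[OF _ h(1), of "\<lambda>_. 1"]
      by (simp add: Bochner_Integration.integral_diff integrable_content_measure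
          measure_content_measure_space space_content_measure)
  qed
  obtain b where b: "b > 0" "\<And>x. x \<in> topspace T \<Longrightarrow> \<bar>f x\<bar> \<le> b"
    using bounded_continuous_map_image[OF compact f] by (auto simp: bounded_pos)
  define h where "h x = (f x + b) / (2 * b)" for x
  have h: "continuous_map T euclideanreal h"
    unfolding h_def using f by (intro continuous_intros) (use b in auto)
  have f_eq: "f = (\<lambda>x. 2 * b * h x - b)"
    using b by (simp add: h_def fun_eq_iff)
  have "0 \<le> h x \<and> h x \<le> 1" if "x \<in> topspace T" for x
    using b(1) b(2)[OF that] by (auto simp: h_def abs_le_iff)
  then have "(\<integral>x. h x \<partial>content_measure) = L h"
    by (rule unit[OF h])
  then have "(\<integral>x. 2 * b * h x - b \<partial>content_measure) = 2 * b * L h - b * L (\<lambda>_. 1)"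
    using integrable_content_measure[OF h]
    by (simp add: Bochner_Integration.integral_diff integrable_content_measure
        measure_content_measure_space space_content_measure)
  also have "\<dots> = L (\<lambda>x. 2 * b * h x - b)"
    using diff[OF continuous_map_real_mult_left[OF h], of "\<lambda>_. b"] scale[OF h] const[of b] by simp
  finally show ?thesis unfolding f_eq .
qed

end

theorem Riesz_Markov:
  assumes "compact_space T" "Hausdorff_space T" "positive_functional T L"
  obtains M where "finite_measure M" "radon_on T M"
    "\<And>f. continuous_map T euclideanreal f \<Longrightarrow> (\<integral>x. f x \<partial>M) = L f"
proof -
  interpret compact_positive_functional T L
    using assms
    by (simp add: compact_positive_functional_def compact_positive_functional_axioms_def)
  show ?thesis
    by (rule that)
      (rule finite_measure_content_measure radon_on_content_measure integral_content_measure)+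
qed

section \<open>States and barycenters\<close>

text \<open>The value 0 on discontinuous functions makes a state determined by its values on continuous
  functions and confines the set of states to a product of compact intervals.\<close>

definition states :: "'a topology \<Rightarrow> (('a \<Rightarrow> real) \<Rightarrow> real) set" where
  "states T = {L. positive_functional T L \<and> L (\<lambda>_. 1) = 1 \<and>
     (\<forall>f. \<not> continuous_map T euclideanreal f \<longrightarrow> L f = 0)}"

lemma positive_functional_add:
  assumes "positive_functional T L" "positive_functional T L'"
  shows "positive_functional T (L + L')"
proof -
  interpret L: positive_functional T L by fact
  interpret L': positive_functional T L' by fact
  show ?thesis
    by unfold_locales (simp_all add: L.add L'.add L.scale L'.scale L.nonneg L'.nonneg algebra_simps)
qed

lemma positive_functional_scaleR:
  assumes "positive_functional T L" "0 \<le> r"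
  shows "positive_functional T (r *\<^sub>R L)"
proof -
  interpret L: positive_functional T L by fact
  show ?thesis
    by unfold_locales (simp_all add: L.add L.scale L.nonneg assms(2) algebra_simps)
qed

lemma convex_states: "convex (states T)"
proof (rule convexI)
  fix L L' :: "('a \<Rightarrow> real) \<Rightarrow> real" and u v :: real
  assume "L \<in> states T" "L' \<in> states T" "0 \<le> u" "0 \<le> v" "u + v = 1"
  then show "u *\<^sub>R L + v *\<^sub>R L' \<in> states T"
    by (simp add: states_def positive_functional_add positive_functional_scaleR)
qed

lemma closed_states: "closed (states T)"
  unfolding states_def positive_functional_def all_conj_distrib imp_conjL
  by (intro closed_Collect_all closed_Collect_conj closed_Collect_imp open_Collect_const
      closed_Collect_eq closed_Collect_le closed_Collect_const
      continuous_intros continuous_on_product_coordinates)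

lemma compact_states:
  assumes "compact_space T"
  shows "compact (states T)"
proof -
  have "\<exists>b. \<forall>x\<in>topspace T. \<bar>f x\<bar> \<le> b" if "continuous_map T euclideanreal f" for f
    using bounded_continuous_map_image[OF assms that] by (auto simp: bounded_iff)
  then obtain b where b: "\<bar>f x\<bar> \<le> b f" if "continuous_map T euclideanreal f" "x \<in> topspace T"
    for f x
    by metis
  have "L f \<in> cball 0 \<bar>b f\<bar>" if "L \<in> states T" for L f
  proof (cases "continuous_map T euclideanreal f")
    case True
    then show ?thesis
      using positive_functional.abs_le[of T L f "b f"] b that by (force simp: states_def)
  next
    case False
    then show ?thesis using that by (simp add: states_def)
  qed
  then have "states T \<subseteq> Pi UNIV (\<lambda>f. cball (0::real) \<bar>b f\<bar>)" by blast
  moreover have "compact (Pi UNIV (\<lambda>f. cball (0::real) \<bar>b f\<bar>))"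
    by (intro compact_Pi_UNIV compact_cball)
  ultimately show ?thesis
    using compact_Int_closed[OF _ closed_states] by (metis inf.absorb2)
qed

lemma eval_in_states:
  assumes "x \<in> topspace T"
  shows "(\<lambda>f. if continuous_map T euclideanreal f then f x else 0) \<in> states T"
proof -
  have "positive_functional T (\<lambda>f. if continuous_map T euclideanreal f then f x else 0)"
    using assms
    by unfold_locales (auto simp: continuous_map_add continuous_map_real_mult_left)
  then show ?thesis by (simp add: states_def)
qed

definition barycenter :: "((('a \<Rightarrow> real ^ 'n) \<Rightarrow> real) \<Rightarrow> real) \<Rightarrow> 'a \<Rightarrow> real ^ 'n" where
  "barycenter L x = (\<chi> n. L (\<lambda>f. f x $ n))"

lemma linear_barycenter: "linear barycenter"
  by (rule linearI) (simp_all add: fun_eq_iff vec_eq_iff barycenter_def)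

lemma continuous_on_barycenter: "continuous_on A barycenter"
  unfolding barycenter_def
  by (intro continuous_on_coordinatewise_then_product continuous_on_vec_lambda
      continuous_on_subset[OF continuous_on_product_coordinates]) simp

section \<open>Positive definite quaternionic functions\<close>

lemma qmul_nth [simp]:
  "qmul p q $ 1 = p$1*q$1 - p$2*q$2 - p$3*q$3 - p$4*q$4"
  "qmul p q $ 2 = p$1*q$2 + p$2*q$1 + p$3*q$4 - p$4*q$3"
  "qmul p q $ 3 = p$1*q$3 - p$2*q$4 + p$3*q$1 + p$4*q$2"
  "qmul p q $ 4 = p$1*q$4 + p$2*q$3 - p$3*q$2 + p$4*q$1"
  by (simp_all add: qmul_def)

lemma qcnj_nth [simp]:
  "qcnj q $ 1 = q$1" "qcnj q $ 2 = - q$2" "qcnj q $ 3 = - q$3" "qcnj q $ 4 = - q$4"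
  by (simp_all add: qcnj_def)

lemma axis_1_nth [simp]:
  "axis (1::4) (r::real) $ 1 = r" "axis (1::4) r $ 2 = 0"
  "axis (1::4) r $ 3 = 0" "axis (1::4) r $ 4 = 0"
  by (simp_all add: axis_def)

lemma quat_eq_iff: "p = q \<longleftrightarrow> p$1 = q$1 \<and> p$2 = q$2 \<and> p$3 = q$3 \<and> p$4 = q$4" for p q :: quat
  by (simp add: vec_eq_iff forall_4)

lemma power2_norm_quat: "(norm q)\<^sup>2 = (q$1)\<^sup>2 + (q$2)\<^sup>2 + (q$3)\<^sup>2 + (q$4)\<^sup>2" for q :: quat
  unfolding power2_norm_eq_inner by (simp add: inner_vec_def sum_4 power2_eq_square)

lemma norm_qmul: "norm (qmul p q) = norm p * norm q"
proof -
  have "(norm (qmul p q))\<^sup>2 = (norm p * norm q)\<^sup>2"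
    unfolding power_mult_distrib power2_norm_quat qmul_nth by algebra
  then show ?thesis by simp
qed

lemma norm_qcnj [simp]: "norm (qcnj q) = norm q"
proof -
  have "(norm (qcnj q))\<^sup>2 = (norm q)\<^sup>2" by (simp add: power2_norm_quat)
  then show ?thesis by simp
qed

interpretation qmul: bounded_bilinear qmul
proof
  show "\<exists>K. \<forall>a b. norm (qmul a b) \<le> norm a * norm b * K"
    by (intro exI[of _ 1]) (simp add: norm_qmul)
qed (simp_all add: quat_eq_iff algebra_simps)

lemma linear_qcnj: "linear qcnj"
  by (rule linearI) (simp_all add: quat_eq_iff)

lemma qmul_assoc: "qmul (qmul p q) r = qmul p (qmul q r)"
  by (simp add: quat_eq_iff algebra_simps)

lemma qcnj_qmul: "qcnj (qmul p q) = qmul (qcnj q) (qcnj p)"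
  by (simp add: quat_eq_iff algebra_simps)

lemma qmul_axis_1 [simp]: "qmul (axis 1 r) q = r *\<^sub>R q" "qmul q (axis 1 r) = r *\<^sub>R q"
  by (simp_all add: quat_eq_iff)

lemma qcnj_axis_1 [simp]: "qcnj (axis 1 r) = axis 1 r"
  by (simp add: quat_eq_iff)

lemma qmul_qcnj: "qmul (qcnj q) q = axis 1 ((norm q)\<^sup>2)" "qmul q (qcnj q) = axis 1 ((norm q)\<^sup>2)"
  unfolding power2_norm_quat by (simp_all add: quat_eq_iff power2_eq_square)

definition qim :: "quat \<Rightarrow> quat" where
  "qim q = q - axis 1 (q$1)"

lemma qim_nth [simp]: "qim q $ 1 = 0" "qim q $ 2 = q $ 2" "qim q $ 3 = q $ 3" "qim q $ 4 = q $ 4"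
  by (simp_all add: qim_def)

lemma power2_norm_eq_qim: "(norm q)\<^sup>2 = (q$1)\<^sup>2 + (norm (qim q))\<^sup>2"
  by (simp add: power2_norm_quat)

lemma qmul_commute_if_qim_parallel:
  assumes "qim q = s *\<^sub>R u"
  shows "qmul u q = qmul q u"
proof -
  have "q = axis 1 (q$1) + s *\<^sub>R u"
    using assms by (simp add: qim_def algebra_simps)
  then show ?thesis
    by (metis qmul.add_left qmul.add_right qmul.scaleR_left qmul.scaleR_right qmul_axis_1)
qed

lemma qnonneg_real_iff: "qnonneg_real q \<longleftrightarrow> q = axis 1 (q$1) \<and> 0 \<le> q$1"
  by (auto simp: qnonneg_real_def quat_eq_iff)

lemma qnonneg_real_axis_1 [simp]: "qnonneg_real (axis 1 r) \<longleftrightarrow> 0 \<le> r"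
  by (simp add: qnonneg_real_def)

lemma qnonneg_real_add: "qnonneg_real p \<Longrightarrow> qnonneg_real q \<Longrightarrow> qnonneg_real (p + q)"
  by (simp add: qnonneg_real_def)

lemma qnonneg_real_scaleR: "0 \<le> r \<Longrightarrow> qnonneg_real q \<Longrightarrow> qnonneg_real (r *\<^sub>R q)"
  by (simp add: qnonneg_real_def)

definition quadratic_form ::
    "('g::ab_group_add \<Rightarrow> quat) \<Rightarrow> 'i set \<Rightarrow> ('i \<Rightarrow> 'g) \<Rightarrow> ('i \<Rightarrow> quat) \<Rightarrow> quat" where
  "quadratic_form \<phi> I g q = (\<Sum>i\<in>I. \<Sum>j\<in>I. qmul (qmul (qcnj (q i)) (\<phi> (g j - g i))) (q j))"

lemma pos_def_iff_quadratic_form: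
  "pos_def \<phi> \<longleftrightarrow> (\<forall>(k::nat) g q. qnonneg_real (quadratic_form \<phi> {1..k} g q))"
  unfolding pos_def_def quadratic_form_def ..

lemma linear_quadratic_form: "linear (\<lambda>\<phi>. quadratic_form \<phi> I g q)"
  by (rule linearI)
    (simp_all add: quadratic_form_def qmul.add_left qmul.add_right qmul.scaleR_left
      qmul.scaleR_right sum.distrib scaleR_sum_right)

lemma pos_def_quadratic_form:
  assumes "pos_def \<phi>" and "finite I"
  shows "qnonneg_real (quadratic_form \<phi> I g q)"
proof -
  obtain h where h: "bij_betw h {1..card I} I"
    using ex_bij_betw_nat_finite_1[OF assms(2)] by blast
  have "quadratic_form \<phi> I g q = quadratic_form \<phi> {1..card I} (g \<circ> h) (q \<circ> h)"
    unfolding quadratic_form_def comp_def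
    by (subst sum.reindex_bij_betw[OF h, symmetric], intro sum.cong refl)
       (subst sum.reindex_bij_betw[OF h, symmetric], simp)
  then show ?thesis
    using assms(1) by (simp add: pos_def_iff_quadratic_form)
qed

lemma pos_def_add: "pos_def \<phi> \<Longrightarrow> pos_def \<psi> \<Longrightarrow> pos_def (\<phi> + \<psi>)"
  by (simp add: pos_def_iff_quadratic_form linear_add[OF linear_quadratic_form] qnonneg_real_add)

lemma pos_def_scaleR: "pos_def \<phi> \<Longrightarrow> 0 \<le> r \<Longrightarrow> pos_def (r *\<^sub>R \<phi>)"
  by (simp add: pos_def_iff_quadratic_form linear_scale[OF linear_quadratic_form]
      qnonneg_real_scaleR)

definition translate_conjugate ::
    "'g::ab_group_add \<Rightarrow> quat \<Rightarrow> ('g \<Rightarrow> quat) \<Rightarrow> 'g \<Rightarrow> quat" where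
  "translate_conjugate a c \<phi> x =
     \<phi> x + qmul (qmul (qcnj c) (\<phi> x)) c + qmul (\<phi> (x + a)) c + qmul (qcnj c) (\<phi> (x - a))"

text \<open>The quadratic form of \<open>translate_conjugate a c \<phi>\<close> at \<open>(g\<^sub>i, q\<^sub>i)\<close> is that of \<open>\<phi>\<close> at the points
  \<open>(g\<^sub>i, q\<^sub>i)\<close> and \<open>(g\<^sub>i + a, c q\<^sub>i)\<close> together.\<close>

lemma pos_def_translate_conjugate:
  fixes \<phi> :: "'g::ab_group_add \<Rightarrow> quat"
  assumes "pos_def \<phi>"
  shows "pos_def (translate_conjugate a c \<phi>)" (is "pos_def ?\<psi>")
  unfolding pos_def_iff_quadratic_form
proof (intro allI)
  fix k :: nat and g :: "nat \<Rightarrow> 'g" and q :: "nat \<Rightarrow> quat"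
  define G where "G = (\<lambda>(i, b). if b then g i + a else g i)"
  define Q where "Q = (\<lambda>(i, b). if b then qmul c (q i) else q i)"
  let ?t = "\<lambda>u v. qmul (qmul (qcnj (Q u)) (\<phi> (G v - G u))) (Q v)"
  have "quadratic_form \<phi> ({1..k} \<times> UNIV) G Q =
      (\<Sum>i\<in>{1..k}. \<Sum>b\<in>UNIV. \<Sum>j\<in>{1..k}. \<Sum>d\<in>UNIV. ?t (i, b) (j, d))"
    unfolding quadratic_form_def sum.cartesian_product' ..
  also have "\<dots> = (\<Sum>i\<in>{1..k}. \<Sum>j\<in>{1..k}. \<Sum>b\<in>UNIV. \<Sum>d\<in>UNIV. ?t (i, b) (j, d))"
    by (intro sum.cong refl sum.swap)
  also have "\<dots> = quadratic_form ?\<psi> {1..k} g q"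
    unfolding quadratic_form_def
  proof (intro sum.cong refl)
    fix i j :: nat
    have diffs: "g j + a - g i = g j - g i + a" "g j - (g i + a) = g j - g i - a"
      by (simp_all add: algebra_simps)
    show "(\<Sum>b\<in>UNIV. \<Sum>d\<in>UNIV. ?t (i, b) (j, d)) = qmul (qmul (qcnj (q i)) (?\<psi> (g j - g i))) (q j)"
      by (simp add: UNIV_bool translate_conjugate_def G_def Q_def diffs
          qmul.add_left qmul.add_right qmul_assoc qcnj_qmul)
  qed
  finally show "qnonneg_real (quadratic_form ?\<psi> {1..k} g q)"
    using pos_def_quadratic_form[OF assms, of "{1..k} \<times> UNIV" G Q] by simp
qed

lemma pos_def_zero: "pos_def \<phi> \<Longrightarrow> qnonneg_real (\<phi> 0)"
  using pos_def_quadratic_form[of \<phi> "{()}" "\<lambda>_. 0" "\<lambda>_. axis 1 1"] by (simp add: quadratic_form_def)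

lemma pos_def_zero_eq: "pos_def \<phi> \<Longrightarrow> \<phi> 0 = axis 1 (\<phi> 0 $ 1)"
  using pos_def_zero qnonneg_real_iff by blast

lemma pos_def_uminus:
  assumes "pos_def \<phi>"
  shows "\<phi> (- a) = qcnj (\<phi> a)"
proof -
  have "qnonneg_real (translate_conjugate a c \<phi> 0)" for c
    by (intro pos_def_zero pos_def_translate_conjugate assms)
  from this[of "axis 1 1"] this[of "axis 2 1"] show ?thesis
    using pos_def_zero[OF assms]
    by (simp add: translate_conjugate_def qnonneg_real_def quat_eq_iff axis_def)
qed

lemma norm_pos_def_le:
  assumes "pos_def \<phi>"
  shows "norm (\<phi> a) \<le> \<phi> 0 $ 1"
proof (cases "\<phi> a = 0")
  case True
  then show ?thesis using pos_def_zero[OF assms] by (simp add: qnonneg_real_def)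
next
  case False
  define c where "c = (- 1 / norm (\<phi> a)) *\<^sub>R qcnj (\<phi> a)"
  have "norm c = 1" using False by (simp add: c_def)
  then have "qmul (qmul (qcnj c) (\<phi> 0)) c = \<phi> 0"
    by (subst (1 2) pos_def_zero_eq[OF assms])
       (simp add: qmul_qcnj quat_eq_iff qmul.scaleR_left del: qmul_nth)
  moreover have "qmul (\<phi> a) c = axis 1 (- norm (\<phi> a))"
    unfolding c_def qmul.scaleR_right qmul_qcnj
    using False by (simp add: quat_eq_iff power2_eq_square)
  moreover have "qmul (qcnj c) (\<phi> (- a)) = qcnj (qmul (\<phi> a) c)"
    by (simp add: qcnj_qmul pos_def_uminus[OF assms])
  ultimately show ?thesis
    using pos_def_zero[OF pos_def_translate_conjugate[OF assms, of a c]]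
    by (simp add: translate_conjugate_def qnonneg_real_def)
qed

lemma pos_def_eq_0:
  assumes "pos_def \<phi>" "\<phi> 0 $ 1 = 0"
  shows "\<phi> = 0"
  using norm_pos_def_le[OF assms(1)] assms(2) by (simp add: fun_eq_iff)

definition pos_def_normalized :: "('g::ab_group_add \<Rightarrow> quat) set" where
  "pos_def_normalized = {\<phi>. pos_def \<phi> \<and> \<phi> 0 = axis 1 1}"

lemma pos_def_normalize:
  assumes "pos_def \<psi>" "\<psi> 0 $ 1 \<noteq> 0"
  shows "(1 / \<psi> 0 $ 1) *\<^sub>R \<psi> \<in> pos_def_normalized"
proof -
  have "pos_def ((1 / \<psi> 0 $ 1) *\<^sub>R \<psi>)"
    using pos_def_zero[OF assms(1)] by (intro pos_def_scaleR assms) (simp add: qnonneg_real_def)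
  moreover have "(1 / \<psi> 0 $ 1) *\<^sub>R \<psi> 0 = axis 1 1"
    using assms(2) pos_def_zero[OF assms(1)] by (simp add: quat_eq_iff qnonneg_real_def)
  ultimately show ?thesis by (simp add: pos_def_normalized_def)
qed

lemma convex_pos_def_normalized: "convex (pos_def_normalized :: ('g::ab_group_add \<Rightarrow> quat) set)"
proof (rule convexI)
  fix \<phi> \<psi> :: "'g \<Rightarrow> quat" and u v :: real
  assume "\<phi> \<in> pos_def_normalized" "\<psi> \<in> pos_def_normalized" "0 \<le> u" "0 \<le> v" "u + v = 1"
  then show "u *\<^sub>R \<phi> + v *\<^sub>R \<psi> \<in> pos_def_normalized"
    by (simp add: pos_def_normalized_def pos_def_add pos_def_scaleR flip: scaleR_left_distrib)
qed

lemma closed_pos_def: "closed {\<phi>. pos_def \<phi>}"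
  unfolding pos_def_def qnonneg_real_def
  by (intro closed_Collect_all closed_Collect_conj closed_Collect_eq closed_Collect_le
      continuous_intros qmul.continuous_on continuous_on_product_coordinates)

lemma closed_pos_def_normalized: "closed (pos_def_normalized :: ('g::ab_group_add \<Rightarrow> quat) set)"
  unfolding pos_def_normalized_def
  by (intro closed_Collect_conj closed_pos_def closed_Collect_eq continuous_intros
      continuous_on_product_coordinates)

lemma compact_pos_def_normalized: "compact (pos_def_normalized :: ('g::ab_group_add \<Rightarrow> quat) set)"
proof -
  have "pos_def_normalized \<subseteq> (UNIV \<rightarrow> cball 0 1 :: ('g \<Rightarrow> quat) set)"
    using norm_pos_def_le by (force simp: pos_def_normalized_def)
  moreover have "compact (UNIV \<rightarrow> cball 0 1 :: ('g \<Rightarrow> quat) set)"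
    by (intro compact_Pi_UNIV compact_cball)
  ultimately show ?thesis
    using compact_Int_closed[OF _ closed_pos_def_normalized] by (metis inf.absorb2)
qed

section \<open>Extreme positive definite functions\<close>

lemma extreme_point_of_convex_combination:
  assumes "p extreme_point_of S" "a \<in> S" "b \<in> S" "0 < t" "t < 1"
    and p: "p = (1 - t) *\<^sub>R a + t *\<^sub>R b"
  shows "b = p"
proof (cases "a = b")
  case True
  then show ?thesis by (simp add: p flip: scaleR_left_distrib)
next
  case False
  then have "p \<in> open_segment a b" using assms(4-6) by (auto simp: in_segment)
  then show ?thesis using assms(1-3) by (auto simp: extreme_point_of_def)
qed

lemma extreme_pos_def_normalizedD:
  assumes "\<phi> extreme_point_of pos_def_normalized"
  shows "pos_def \<phi>" "\<phi> 0 = axis 1 1"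
  using assms by (simp_all add: extreme_point_of_def pos_def_normalized_def)

lemma extreme_pos_def_dominated:
  assumes extreme: "\<phi> extreme_point_of pos_def_normalized"
    and \<psi>: "pos_def \<psi>" "pos_def (\<phi> - \<psi>)"
  shows "\<psi> = (\<psi> 0 $ 1) *\<^sub>R \<phi>"
proof -
  define t where "t = \<psi> 0 $ 1"
  note \<phi>_zero = extreme_pos_def_normalizedD(2)[OF extreme]
  have "0 \<le> t" "t \<le> 1"
    using pos_def_zero[OF \<psi>(1)] pos_def_zero[OF \<psi>(2)] by (simp_all add: qnonneg_real_def t_def \<phi>_zero)
  then consider "t = 0" | "t = 1" | "0 < t" "t < 1"
    by linarith
  then have "\<psi> = t *\<^sub>R \<phi>"
  proof cases
    case 1
    then show ?thesis using pos_def_eq_0[OF \<psi>(1)] by (simp add: t_def)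
  next
    case 2
    then show ?thesis using pos_def_eq_0[OF \<psi>(2)] by (simp add: t_def \<phi>_zero)
  next
    case 3
    have "(1 / t) *\<^sub>R \<psi> = \<phi>"
    proof (rule extreme_point_of_convex_combination[OF extreme])
      show "(1 / (1 - t)) *\<^sub>R (\<phi> - \<psi>) \<in> pos_def_normalized"
        using pos_def_normalize[OF \<psi>(2)] 3 by (simp add: t_def \<phi>_zero)
      show "(1 / t) *\<^sub>R \<psi> \<in> pos_def_normalized"
        using pos_def_normalize[OF \<psi>(1)] 3 by (simp add: t_def)
      show "\<phi> = (1 - t) *\<^sub>R (1 / (1 - t)) *\<^sub>R (\<phi> - \<psi>) + t *\<^sub>R (1 / t) *\<^sub>R \<psi>"
        using 3 by simp
    qed (use 3 in auto)
    then show ?thesis using 3 by auto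
  qed
  then show ?thesis by (simp add: t_def)
qed

lemma extreme_pos_def_translate:
  assumes extreme: "\<phi> extreme_point_of pos_def_normalized"
    and c: "norm c = 1" and commute: "\<And>x. qmul c (\<phi> x) = qmul (\<phi> x) c"
  shows "qmul (\<phi> (x + a)) c + qmul (qcnj c) (\<phi> (x - a)) = (2 * (qmul (\<phi> a) c $ 1)) *\<^sub>R \<phi> x"
proof -
  note pos_def = extreme_pos_def_normalizedD(1)[OF extreme]
    and \<phi>_zero = extreme_pos_def_normalizedD(2)[OF extreme]
  define D where "D x = qmul (\<phi> (x + a)) c + qmul (qcnj c) (\<phi> (x - a))" for x
  define \<psi> where "\<psi> = (1 / 4) *\<^sub>R (2 *\<^sub>R \<phi> + D)"
  have conjugate: "qmul (qmul (qcnj c) (\<phi> x)) c = \<phi> x" for x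
    using c by (simp add: qmul_assoc flip: commute) (simp add: qmul_qcnj flip: qmul_assoc)
  have "2 *\<^sub>R \<phi> + D = translate_conjugate a c \<phi>"
    by (simp add: fun_eq_iff translate_conjugate_def conjugate D_def scaleR_2)
  then have "pos_def \<psi>"
    by (simp add: \<psi>_def pos_def_scaleR pos_def_translate_conjugate[OF pos_def])
  moreover have "2 *\<^sub>R \<phi> - D = translate_conjugate a (- c) \<phi>"
    by (simp add: fun_eq_iff translate_conjugate_def conjugate D_def scaleR_2
        linear_neg[OF linear_qcnj] qmul.minus_left qmul.minus_right)
  then have "pos_def ((1 / 4) *\<^sub>R (2 *\<^sub>R \<phi> - D))"
    by (simp add: pos_def_scaleR pos_def_translate_conjugate[OF pos_def])
  moreover have "(1 / 4) *\<^sub>R (2 *\<^sub>R \<phi> - D) = \<phi> - \<psi>"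
    by (simp add: \<psi>_def fun_eq_iff quat_eq_iff field_simps)
  ultimately have \<psi>_eq: "\<psi> = (\<psi> 0 $ 1) *\<^sub>R \<phi>"
    by (intro extreme_pos_def_dominated[OF extreme]) auto
  have "2 *\<^sub>R \<phi> x + D x = 4 *\<^sub>R \<psi> x"
    by (simp add: \<psi>_def)
  also have "\<dots> = (4 * (\<psi> 0 $ 1)) *\<^sub>R \<phi> x"
    by (subst \<psi>_eq) simp
  also have "4 * (\<psi> 0 $ 1) = 2 + 2 * (qmul (\<phi> a) c $ 1)"
    using pos_def_uminus[OF pos_def, of a] by (simp add: \<psi>_def D_def \<phi>_zero)
  finally show ?thesis
    by (simp add: D_def scaleR_left_distrib)
qed

lemma d_alembert_odd_imp_sine_addition:
  fixes R :: "'g::ab_group_add \<Rightarrow> real" and V :: "'g \<Rightarrow> 'b::real_vector"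
  assumes "\<And>x a. V (x + a) + V (x - a) = (2 * R a) *\<^sub>R V x" and "\<And>x. V (- x) = - V x"
  shows "V (x + a) = R a *\<^sub>R V x + R x *\<^sub>R V a"
proof -
  have "2 *\<^sub>R V (x + a) = (V (x + a) + V (x - a)) + (V (a + x) + V (a - x))"
    using assms(2)[of "x - a"] by (simp add: scaleR_2 add.commute)
  also have "\<dots> = 2 *\<^sub>R (R a *\<^sub>R V x + R x *\<^sub>R V a)"
    unfolding assms(1) by (simp add: scaleR_add_right)
  finally show ?thesis by simp
qed

lemma sine_addition_collinear:
  fixes R :: "'g::ab_group_add \<Rightarrow> real" and V :: "'g \<Rightarrow> 'b::real_vector"
  assumes "\<And>x a. V (x + a) = R a *\<^sub>R V x + R x *\<^sub>R V a"
  shows "(R y * R z - R (y + z)) *\<^sub>R V x = (R x * R y - R (x + y)) *\<^sub>R V z"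
proof -
  have "V (x + (y + z)) = V ((x + y) + z)" by (simp add: add.assoc)
  then show ?thesis
    unfolding assms by (simp add: algebra_simps)
qed

lemma extreme_pos_def_qim_sine_addition:
  assumes extreme: "\<phi> extreme_point_of pos_def_normalized"
  shows "qim (\<phi> (x + a)) = (\<phi> a $ 1) *\<^sub>R qim (\<phi> x) + (\<phi> x $ 1) *\<^sub>R qim (\<phi> a)"
proof (rule d_alembert_odd_imp_sine_addition)
  fix x a
  have "\<phi> (x + a) + \<phi> (x - a) = (2 * (\<phi> a $ 1)) *\<^sub>R \<phi> x"
    using extreme_pos_def_translate[OF extreme, of "axis 1 1" x a] by simp
  then show "qim (\<phi> (x + a)) + qim (\<phi> (x - a)) = (2 * (\<phi> a $ 1)) *\<^sub>R qim (\<phi> x)"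
    by (simp add: quat_eq_iff)
  show "qim (\<phi> (- x)) = - qim (\<phi> x)"
    by (simp add: pos_def_uminus[OF extreme_pos_def_normalizedD(1)[OF extreme]] quat_eq_iff)
qed

lemma extreme_pos_def_qim_parallel:
  assumes extreme: "\<phi> extreme_point_of pos_def_normalized"
  obtains u where "norm u = 1" "u $ 1 = 0" "\<And>x. \<exists>s. qim (\<phi> x) = s *\<^sub>R u"
proof (cases "\<forall>x. qim (\<phi> x) = 0")
  case True
  have "norm (axis 2 1 :: quat) = 1" "(axis 2 1 :: quat) $ 1 = 0"
    by simp (simp add: axis_def)
  with True show ?thesis
    by (intro that[of "axis 2 1"]) (auto intro: exI[of _ 0])
next
  case False
  then obtain w where w: "qim (\<phi> w) \<noteq> 0" by blast
  note pos_def = extreme_pos_def_normalizedD(1)[OF extreme]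
    and \<phi>_zero = extreme_pos_def_normalizedD(2)[OF extreme]
  have parallel: "((\<phi> w $ 1)\<^sup>2 - 1) *\<^sub>R qim (\<phi> x) =
      (\<phi> x $ 1 * \<phi> w $ 1 - \<phi> (x - w) $ 1) *\<^sub>R qim (\<phi> w)" for x
    using sine_addition_collinear[of "\<lambda>x. qim (\<phi> x)",
        OF extreme_pos_def_qim_sine_addition[OF extreme], of "- w" w x]
    by (simp add: pos_def_uminus[OF pos_def] \<phi>_zero power2_eq_square)
  have "(norm (\<phi> w))\<^sup>2 \<le> 1"
    using norm_pos_def_le[OF pos_def, of w] by (simp add: \<phi>_zero power_le_one)
  moreover have "0 < (norm (qim (\<phi> w)))\<^sup>2" using w by simp
  ultimately have nonzero: "(\<phi> w $ 1)\<^sup>2 - 1 \<noteq> 0"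
    using power2_norm_eq_qim[of "\<phi> w"] by linarith
  have "\<exists>s. qim (\<phi> x) = s *\<^sub>R sgn (qim (\<phi> w))" for x
  proof -
    obtain k where "((\<phi> w $ 1)\<^sup>2 - 1) *\<^sub>R qim (\<phi> x) = k *\<^sub>R qim (\<phi> w)"
      using parallel[of x] by blast
    then have "qim (\<phi> x) = (k / ((\<phi> w $ 1)\<^sup>2 - 1)) *\<^sub>R qim (\<phi> w)"
      using nonzero by (simp add: eq_vector_fraction_iff)
    also have "qim (\<phi> w) = norm (qim (\<phi> w)) *\<^sub>R sgn (qim (\<phi> w))"
      using w by (simp add: sgn_div_norm)
    finally show ?thesis by (metis scaleR_scaleR)
  qed
  then show ?thesis
    using w by (intro that[of "sgn (qim (\<phi> w))"]) (simp_all add: norm_sgn sgn_div_norm)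
qed

lemma extreme_pos_def_add:
  assumes extreme: "\<phi> extreme_point_of pos_def_normalized"
  shows "\<phi> (x + a) = qmul (\<phi> a) (\<phi> x)"
proof -
  obtain u where u: "norm u = 1" "u $ 1 = 0" and parallel: "\<And>x. \<exists>s. qim (\<phi> x) = s *\<^sub>R u"
    using extreme_pos_def_qim_parallel[OF extreme] by blast
  have commute: "qmul u (\<phi> x) = qmul (\<phi> x) u" for x
    using parallel[of x] qmul_commute_if_qim_parallel by blast
  have qcnj_u: "qcnj u = - u" using u by (simp add: quat_eq_iff)
  have u_squared: "qmul u u = axis 1 (- 1)"
    using qmul_qcnj(1)[of u] u(1) by (simp add: qcnj_u qmul.minus_left quat_eq_iff)
  obtain r s where \<phi>a: "\<phi> a = axis 1 r + s *\<^sub>R u"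
    using parallel[of a] by (metis qim_def add.commute diff_add_cancel)
  have "\<phi> a $ 1 = r" "qmul (\<phi> a) u $ 1 = - s"
    by (simp_all add: \<phi>a qmul.add_left qmul.scaleR_left u_squared u(2) del: qmul_nth)
  then have sum: "\<phi> (x + a) + \<phi> (x - a) = (2 * r) *\<^sub>R \<phi> x"
    and "qmul u (\<phi> (x + a) - \<phi> (x - a)) = - (2 * s) *\<^sub>R \<phi> x"
    using extreme_pos_def_translate[OF extreme, of "axis 1 1" x a]
      extreme_pos_def_translate[OF extreme u(1) commute, of x a]
    by (simp_all add: qcnj_u commute qmul.minus_left qmul.diff_right)
  then have "qmul (qmul u u) (\<phi> (x + a) - \<phi> (x - a)) = - (2 * s) *\<^sub>R qmul u (\<phi> x)"
    by (simp add: qmul_assoc qmul.scaleR_right qmul.minus_right)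
  then have diff: "\<phi> (x + a) - \<phi> (x - a) = (2 * s) *\<^sub>R qmul u (\<phi> x)"
    by (simp add: u_squared) (metis minus_diff_eq minus_minus)
  have "2 *\<^sub>R \<phi> (x + a) = (\<phi> (x + a) + \<phi> (x - a)) + (\<phi> (x + a) - \<phi> (x - a))"
    by (simp add: scaleR_2)
  also have "\<dots> = 2 *\<^sub>R qmul (\<phi> a) (\<phi> x)"
    unfolding sum diff by (simp add: \<phi>a qmul.add_left qmul.scaleR_left scaleR_add_right)
  finally show ?thesis by simp
qed

lemma extreme_pos_def_in_qdual:
  assumes extreme: "\<phi> extreme_point_of pos_def_normalized"
  shows "\<phi> \<in> qdual"
proof -
  note pos_def = extreme_pos_def_normalizedD(1)[OF extreme]
    and \<phi>_zero = extreme_pos_def_normalizedD(2)[OF extreme]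
  have "norm (\<phi> a) = 1" for a
  proof -
    have "axis 1 ((norm (\<phi> a))\<^sup>2) = (axis 1 1 :: quat)"
      using extreme_pos_def_add[OF extreme, of "- a" a]
      by (simp add: \<phi>_zero pos_def_uminus[OF pos_def] qmul_qcnj)
    then show ?thesis
      using norm_ge_zero[of "\<phi> a"] by (simp add: quat_eq_iff power2_eq_1_iff)
  qed
  moreover have "\<phi> (a + b) = qmul (\<phi> a) (\<phi> b)" for a b
    using extreme_pos_def_add[OF extreme, of b a] by (simp add: add.commute)
  ultimately show ?thesis by (simp add: qdual_def)
qed

section \<open>Measures on the quaternionic dual\<close>

lemma qdual_norm: "\<gamma> \<in> qdual \<Longrightarrow> norm (\<gamma> a) = 1"
  by (simp add: qdual_def)

lemma qdual_add: "\<gamma> \<in> qdual \<Longrightarrow> \<gamma> (a + b) = qmul (\<gamma> a) (\<gamma> b)"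
  by (simp add: qdual_def)

lemma qdual_zero:
  assumes "\<gamma> \<in> qdual"
  shows "\<gamma> 0 = axis 1 1"
proof -
  have "qmul (qcnj (\<gamma> 0)) (\<gamma> 0) = qmul (qcnj (\<gamma> 0)) (qmul (\<gamma> 0) (\<gamma> 0))"
    using qdual_add[OF assms, of 0 0] by simp
  then show ?thesis
    using qdual_norm[OF assms, of 0] by (simp add: qmul_qcnj flip: qmul_assoc)
qed

lemma qdual_uminus:
  assumes "\<gamma> \<in> qdual"
  shows "\<gamma> (- a) = qcnj (\<gamma> a)"
proof -
  have "qmul (qmul (\<gamma> (- a)) (\<gamma> a)) (qcnj (\<gamma> a)) = qcnj (\<gamma> a)"
    unfolding qdual_add[OF assms, symmetric] by (simp add: qdual_zero[OF assms])
  then show ?thesis using qdual_norm[OF assms, of a] by (simp add: qmul_assoc qmul_qcnj)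
qed

lemma quadratic_form_qdual:
  assumes "\<gamma> \<in> qdual"
  shows "quadratic_form \<gamma> I g q = axis 1 ((norm (\<Sum>i\<in>I. qmul (\<gamma> (g i)) (q i)))\<^sup>2)"
proof -
  have "qmul (qmul (qcnj (q i)) (\<gamma> (g j - g i))) (q j) =
      qmul (qcnj (qmul (\<gamma> (g i)) (q i))) (qmul (\<gamma> (g j)) (q j))" for i j
    using qdual_add[OF assms, of "- g i" "g j"]
    by (simp add: qdual_uminus[OF assms] qcnj_qmul qmul_assoc)
  then show ?thesis
    by (simp add: quadratic_form_def qmul_qcnj(1)[symmetric] linear_sum[OF linear_qcnj]
        qmul.sum_left qmul.sum_right) (rule sum.swap)
qed

lemma pos_def_qdual: "\<gamma> \<in> qdual \<Longrightarrow> pos_def \<gamma>"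
  by (simp add: pos_def_iff_quadratic_form quadratic_form_qdual)

lemma qnonneg_real_integral:
  assumes "integrable M f" "\<And>x. x \<in> space M \<Longrightarrow> qnonneg_real (f x)"
  shows "qnonneg_real (\<integral>x. f x \<partial>M)"
proof -
  have component: "(\<integral>x. f x \<partial>M) $ n = (\<integral>x. f x $ n \<partial>M)" for n
    using integral_bounded_linear[OF bounded_linear_vec_nth assms(1)] by simp
  have "(\<integral>x. f x $ n \<partial>M) = 0" if "n \<in> {2, 3, 4}" for n
    using assms(2) that by (intro integral_eq_zero_AE AE_I2) (auto simp: qnonneg_real_def)
  moreover have "0 \<le> (\<integral>x. f x $ 1 \<partial>M)"
    using assms(2)
    by (intro Bochner_Integration.integral_nonneg_AE AE_I2) (auto simp: qnonneg_real_def)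
  ultimately show ?thesis
    by (simp add: qnonneg_real_def component)
qed

lemma pos_def_integral:
  fixes F :: "'a \<Rightarrow> 'g::ab_group_add \<Rightarrow> quat"
  assumes int: "\<And>g. integrable M (\<lambda>x. F x g)" and pos_def: "\<And>x. x \<in> space M \<Longrightarrow> pos_def (F x)"
  shows "pos_def (\<lambda>g. \<integral>x. F x g \<partial>M)"
  unfolding pos_def_iff_quadratic_form
proof (intro allI)
  fix k :: nat and g :: "nat \<Rightarrow> 'g" and q :: "nat \<Rightarrow> quat"
  have linear: "bounded_linear (\<lambda>v. qmul (qmul a v) b)" for a b
    by (rule bounded_linear_compose[OF qmul.bounded_linear_left qmul.bounded_linear_right])
  note int_terms = integrable_bounded_linear[OF linear int]
  have "quadratic_form (\<lambda>g. \<integral>x. F x g \<partial>M) {1..k} g q = (\<integral>x. quadratic_form (F x) {1..k} g q \<partial>M)"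
    by (simp add: quadratic_form_def Bochner_Integration.integral_sum int_terms
        integral_bounded_linear[OF linear int])
  moreover have "integrable M (\<lambda>x. quadratic_form (F x) {1..k} g q)"
    unfolding quadratic_form_def by (intro Bochner_Integration.integrable_sum int_terms)
  then have "qnonneg_real (\<integral>x. quadratic_form (F x) {1..k} g q \<partial>M)"
    by (rule qnonneg_real_integral) (intro pos_def_quadratic_form pos_def finite_atLeastAtMost)
  ultimately show "qnonneg_real (quadratic_form (\<lambda>g. \<integral>x. F x g \<partial>M) {1..k} g q)"
    by simp
qed

lemma topspace_qdual_top [simp]: "topspace qdual_top = qdual"
  by (simp add: qdual_top_def)

lemma compact_qdual: "compact (qdual :: ('g::ab_group_add \<Rightarrow> quat) set)"
proof -
  have qdual_eq: "qdual = (UNIV \<rightarrow> sphere 0 1) \<inter> {\<gamma> :: 'g \<Rightarrow> quat. \<forall>a b. \<gamma> (a + b) = qmul (\<gamma> a) (\<gamma> b)}"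
    by (auto simp: qdual_def)
  show ?thesis
    unfolding qdual_eq
    by (intro compact_Int_closed compact_Pi_UNIV compact_sphere closed_Collect_all closed_Collect_eq
        qmul.continuous_on continuous_on_product_coordinates)
qed

lemma compact_space_qdual_top: "compact_space (qdual_top :: ('g::ab_group_add \<Rightarrow> quat) topology)"
  using compact_qdual unfolding qdual_top_def euclidean_product_topology
  by (intro compact_space_subtopology) simp

lemma Hausdorff_space_qdual_top: "Hausdorff_space qdual_top"
  unfolding qdual_top_def
  by (intro Hausdorff_space_subtopology)
    (simp add: Hausdorff_space_product_topology Hausdorff_space_euclidean)

lemma continuous_map_qdual_top_eval: "continuous_map qdual_top euclidean (\<lambda>\<gamma>. \<gamma> g)"
  unfolding qdual_top_def
  by (intro continuous_map_from_subtopology continuous_map_product_projection) simp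

lemma continuous_map_qdual_top_component: "continuous_map qdual_top euclideanreal (\<lambda>\<gamma>. \<gamma> g $ n)"
  using continuous_map_compose[OF continuous_map_qdual_top_eval, of euclideanreal "\<lambda>v. v $ n"]
  by (simp add: o_def continuous_intros)

lemma pos_def_if_radon_representation:
  assumes M: "finite_measure M" "radon_on qdual_top M"
    and \<phi>: "\<And>g n. \<phi> g $ n = (\<integral>\<gamma>. \<gamma> g $ n \<partial>M)"
  shows "pos_def \<phi>"
proof -
  have int: "integrable M (\<lambda>\<gamma>. \<gamma> g)" for g
    by (intro integrable_radon_on_continuous_map[OF M] compact_space_qdual_top
        continuous_map_qdual_top_eval)
  have "pos_def \<gamma>" if "\<gamma> \<in> space M" for \<gamma>
    using that M(2) by (simp add: radon_on_def pos_def_qdual)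
  with int have "pos_def (\<lambda>g. \<integral>\<gamma>. \<gamma> g \<partial>M)"
    by (rule pos_def_integral)
  moreover have "\<phi> = (\<lambda>g. \<integral>\<gamma>. \<gamma> g \<partial>M)"
    using integral_bounded_linear[OF bounded_linear_vec_nth int]
    by (simp add: fun_eq_iff vec_eq_iff \<phi>)
  ultimately show ?thesis by simp
qed

lemma pos_def_normalized_subset_barycenters:
  "(pos_def_normalized :: ('g::ab_group_add \<Rightarrow> quat) set) \<subseteq> barycenter ` states qdual_top"
proof (rule compact_convex_subset_if_extreme_points)
  show "compact (barycenter ` states (qdual_top :: ('g \<Rightarrow> quat) topology))"
    by (intro compact_continuous_image continuous_on_barycenter compact_states
        compact_space_qdual_top)
  show "convex (barycenter ` states (qdual_top :: ('g \<Rightarrow> quat) topology))"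
    by (intro convex_linear_image linear_barycenter convex_states)
  fix \<gamma> :: "'g \<Rightarrow> quat"
  assume "\<gamma> extreme_point_of pos_def_normalized"
  then have "\<gamma> \<in> qdual" by (rule extreme_pos_def_in_qdual)
  moreover have "barycenter (\<lambda>f. if continuous_map qdual_top euclideanreal f then f \<gamma> else 0) = \<gamma>"
    by (simp add: fun_eq_iff vec_eq_iff barycenter_def continuous_map_qdual_top_component)
  ultimately show "\<gamma> \<in> barycenter ` states qdual_top"
    using eval_in_states[of \<gamma> qdual_top] by (force intro!: image_eqI)
qed (rule compact_pos_def_normalized closed_pos_def_normalized convex_pos_def_normalized)+

lemma pos_def_imp_barycenter:
  assumes "pos_def \<phi>"
  obtains L where "positive_functional qdual_top L" "barycenter L = \<phi>"
proof (cases "\<phi> 0 $ 1 = 0")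
  case True
  have "positive_functional qdual_top 0" by unfold_locales auto
  moreover have "barycenter 0 = (0 :: 'a \<Rightarrow> quat)"
    by (rule linear_0[OF linear_barycenter])
  ultimately show ?thesis
    using that pos_def_eq_0[OF assms True] by metis
next
  case False
  let ?c = "\<phi> 0 $ 1"
  obtain L where L: "L \<in> states qdual_top" "barycenter L = (1 / ?c) *\<^sub>R \<phi>"
    using subsetD[OF pos_def_normalized_subset_barycenters pos_def_normalize[OF assms False]]
    by auto
  have "0 \<le> ?c"
    using pos_def_zero[OF assms] by (simp add: qnonneg_real_def)
  then have "positive_functional qdual_top (?c *\<^sub>R L)"
    using L(1) by (simp add: states_def positive_functional_scaleR)
  moreover have "barycenter (?c *\<^sub>R L) = \<phi>"
    using False by (simp add: linear_scale[OF linear_barycenter] L(2))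
  ultimately show ?thesis by (rule that)
qed

theorem mainTheorem12:
  fixes \<phi> :: "'g::ab_group_add \<Rightarrow> quat"
  shows "pos_def \<phi> \<longleftrightarrow>
    (\<exists>M :: ('g \<Rightarrow> quat) measure.
       finite_measure M \<and> radon_on qdual_top M \<and>
       (\<forall>g (n::4). \<phi> g $ n = (\<integral>\<gamma>. \<gamma> g $ n \<partial>M)))"
proof
  assume "pos_def \<phi>"
  then obtain L where L: "positive_functional qdual_top L" "barycenter L = \<phi>"
    by (rule pos_def_imp_barycenter)
  obtain M where M: "finite_measure M" "radon_on qdual_top M"
    and L_eq: "\<And>f. continuous_map qdual_top euclideanreal f \<Longrightarrow> (\<integral>\<gamma>. f \<gamma> \<partial>M) = L f"
    using Riesz_Markov[OF compact_space_qdual_top Hausdorff_space_qdual_top L(1)] by blast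
  have "\<phi> g $ n = (\<integral>\<gamma>. \<gamma> g $ n \<partial>M)" for g n
    by (simp add: L_eq[OF continuous_map_qdual_top_component] barycenter_def flip: L(2))
  with M show "\<exists>M. finite_measure M \<and> radon_on qdual_top M \<and> (\<forall>g n. \<phi> g $ n = (\<integral>\<gamma>. \<gamma> g $ n \<partial>M))"
    by blast
next
  assume "\<exists>M. finite_measure M \<and> radon_on qdual_top M \<and> (\<forall>g n. \<phi> g $ n = (\<integral>\<gamma>. \<gamma> g $ n \<partial>M))"
  then show "pos_def \<phi>" using pos_def_if_radon_representation by blast
qed

end
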